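(* Let $S_1,S_2,\dots$ be $\mu$-preserving Borel involutions of $X=\{0,1\}^{\mathbb N}$ that form a treeing of the equivalence relation they generate, and let $\Gamma=\langle\gamma_1,\gamma_2,\dots\mid\gamma_i^2=1\ (i\ge1)\rangle$ act on $X$ by $\theta(\gamma_i,x)=S_i(x)$. Then this action (regarded as an action of $\mathbb F_\infty$ through the quotient map $\mathbb F_\infty\to\Gamma$) is sofic. Consequently every treeable measure-preserving equivalence relation on $(X,\mu)$, in particular the orbit relation of any free $\mu$-preserving action of a free group, is sofic.
   Context: $X=\{0,1\}^{\mathbb N}$ with product uniform measure $\mu$. The involutions $S_i$ form a treeing if for $\mu$-a.e. $x$ the graph on the orbit of $x$, with an edge labelled $i$ between $y$ and $S_i(y)$ whenever $S_i(y)\ne y$, is a tree (no cycles, including no two distinct labelled edges joining the same pair of points). An equivalence relation is treeable if it admits such a generating family. $\mathbb F_\infty$ is free on $\gamma_1,\gamma_2,\dots$; $W_r$ the reduced words of length $\le r$ in $\gamma_1^{\pm1},\dots,\gamma_r^{\pm1}$. For an action $\theta$ of $\mathbb F_\infty$ on $X$ or on a finite set $Y$ whose points carry labels in $\{0,1\}^{\mathbb N}$ (points of $X$ labelled by themselves), $B^r_r(x)$ is the rooted directed multigraph on vertex set $\theta(W_r,x)$, root $x$, with an edge $y\to\theta(\gamma_i^\epsilon,y)$ coloured $\gamma_i^\epsilon$ for each vertex $y$, $i\le r$, $\epsilon=\pm1$ with $\theta(\gamma_i^\epsilon,y)$ a vertex, vertices labelled by the first $r$ digits of their labels; $U^{r,r}$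 is the finite set of isomorphism types; $p_\alpha(\theta)$ is the measure (on $X$) resp. proportion (on $Y$) of $x$ with $B^r_r(x)\cong\alpha$. A $\mu$-preserving Borel action $\theta$ on $X$ is sofic if there are actions $\theta_n$ on labelled finite sets with $p_\alpha(\theta_n)\to p_\alpha(\theta)$ for all $r\ge1$, $\alpha\in U^{r,r}$; a $\mu$-preserving countable Borel equivalence relation is sofic if it is the orbit relation of a sofic action. *)

theory Defs
  imports "HOL-Probability.Probability"
begin

type_synonym pt = "nat \<Rightarrow> bool"

text \<open>The uniform product (Bernoulli(1/2)) measure on X; its sigma-algebra is the
  product = Borel sigma-algebra of the Cantor space.\<close>
definition mu :: "pt measure" where
  "mu = PiM UNIV (\<lambda>_. measure_pmf (bernoulli_pmf (1/2)))"

text \<open>Letters of F_infinity: (i, True) is gamma_i, (i, False) is gamma_i^(-1).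
  Generators are indexed from 0 (gamma_1, gamma_2, ... of the paper are indices 0, 1, ...).
  An action of F_infinity on a carrier A is given by the bijections T i = theta(gamma_i).\<close>
definition mpres :: "(pt \<Rightarrow> pt) \<Rightarrow> bool" where
  "mpres f \<longleftrightarrow> f \<in> measurable mu mu \<and> distr mu mu f = mu"

type_synonym letter = "nat \<times> bool"

definition act_letter :: "'a set \<Rightarrow> (nat \<Rightarrow> 'a \<Rightarrow> 'a) \<Rightarrow> letter \<Rightarrow> 'a \<Rightarrow> 'a" where
  "act_letter A T l y = (if snd l then T (fst l) y else inv_into A (T (fst l)) y)"

definition act_word :: "'a set \<Rightarrow> (nat \<Rightarrow> 'a \<Rightarrow> 'a) \<Rightarrow> letter list \<Rightarrow> 'a \<Rightarrow> 'a" where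
  "act_word A T w x = foldr (act_letter A T) w x"

fun reduced :: "letter list \<Rightarrow> bool" where
  "reduced (a # b # w) = (\<not> (fst a = fst b \<and> snd a \<noteq> snd b) \<and> reduced (b # w))"
| "reduced _ = True"

definition W :: "nat \<Rightarrow> letter list set" where
  "W r = {w. reduced w \<and> length w \<le> r \<and> (\<forall>l\<in>set w. fst l < r)}"

text \<open>Rooted directed multigraphs with edges coloured by letters (at most one edge of each
  colour out of each vertex) and vertex labels.\<close>
record 'v rgraph =
  verts :: "'v set"
  root :: 'v
  edge :: "'v \<Rightarrow> letter \<Rightarrow> 'v option"
  vlab :: "'v \<Rightarrow> bool list"

definition ball :: "nat \<Rightarrow> 'a set \<Rightarrow> (nat \<Rightarrow> 'a \<Rightarrow> 'a) \<Rightarrow> ('a \<Rightarrow> pt) \<Rightarrow> 'a \<Rightarrow> 'a rgraph" where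
  "ball r A T L x =
    (let V = (\<lambda>w. act_word A T w x) ` W r in
     \<lparr>verts = V, root = x,
      edge = (\<lambda>y l. if y \<in> V \<and> fst l < r \<and> act_letter A T l y \<in> V
                    then Some (act_letter A T l y) else None),
      vlab = (\<lambda>y. map (L y) [0..<r])\<rparr>)"

definition rg_iso :: "'a rgraph \<Rightarrow> 'b rgraph \<Rightarrow> bool" where
  "rg_iso G H \<longleftrightarrow> (\<exists>f. bij_betw f (verts G) (verts H) \<and> f (root G) = root H \<and>
     (\<forall>v\<in>verts G. vlab H (f v) = vlab G v \<and> (\<forall>l. edge H (f v) l = map_option f (edge G v l))))"

text \<open>p_alpha(theta) for an action on X (points labelled by themselves); isomorphism types
  alpha are represented by graphs on nat (every such finite graph has such a representative).\<close>
definition p_X :: "(nat \<Rightarrow> pt \<Rightarrow> pt) \<Rightarrow> nat \<Rightarrow> nat rgraph \<Rightarrow> real" where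
  "p_X T r \<alpha> = measure mu {x \<in> space mu. rg_iso (ball r UNIV T (\<lambda>y. y) x) \<alpha>}"

text \<open>p_alpha for an action sigma on a labelled finite set Y (w.l.o.g. Y a subset of nat).\<close>
definition p_fin :: "nat set \<Rightarrow> (nat \<Rightarrow> nat \<Rightarrow> nat) \<Rightarrow> (nat \<Rightarrow> pt) \<Rightarrow> nat \<Rightarrow> nat rgraph \<Rightarrow> real" where
  "p_fin Y \<sigma> L r \<alpha> = real (card {y \<in> Y. rg_iso (ball r Y \<sigma> L y) \<alpha>}) / real (card Y)"

definition fin_action :: "nat set \<Rightarrow> (nat \<Rightarrow> nat \<Rightarrow> nat) \<Rightarrow> bool" where
  "fin_action Y \<sigma> \<longleftrightarrow> finite Y \<and> Y \<noteq> {} \<and> (\<forall>i. bij_betw (\<sigma> i) Y Y)"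

definition sofic_action :: "(nat \<Rightarrow> pt \<Rightarrow> pt) \<Rightarrow> bool" where
  "sofic_action T \<longleftrightarrow>
    (\<exists>Y \<sigma> L. (\<forall>n. fin_action (Y n) (\<sigma> n)) \<and>
       (\<forall>r\<ge>1. \<forall>\<alpha>. (\<lambda>n. p_fin (Y n) (\<sigma> n) (L n) r \<alpha>) \<longlonglongrightarrow> p_X T r \<alpha>))"

definition mp_action :: "(nat \<Rightarrow> pt \<Rightarrow> pt) \<Rightarrow> bool" where
  "mp_action T \<longleftrightarrow> (\<forall>i. bij (T i) \<and> mpres (T i)
                       \<and> mpres (inv (T i)))"

definition orbit_rel :: "(nat \<Rightarrow> pt \<Rightarrow> pt) \<Rightarrow> (pt \<times> pt) set" where
  "orbit_rel T = {(x, act_word UNIV T w x) | x w. True}"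

text \<open>A non-backtracking closed walk of positive length starting at y in the graph with an
  edge labelled i between z and S i z whenever S i z differs from z.\<close>
definition closed_walk :: "(nat \<Rightarrow> pt \<Rightarrow> pt) \<Rightarrow> pt \<Rightarrow> nat list \<Rightarrow> bool" where
  "closed_walk S y ws \<longleftrightarrow> ws \<noteq> [] \<and>
     (\<forall>j < length ws. S (ws ! j) (fold S (take j ws) y) \<noteq> fold S (take j ws) y) \<and>
     (\<forall>j. Suc j < length ws \<longrightarrow> ws ! j \<noteq> ws ! Suc j) \<and>
     fold S ws y = y"

text \<open>The involutions S form a treeing: for a.e. x the labelled graph on the orbit of x
  has no cycles (it is connected by construction).\<close>
definition treeing :: "(nat \<Rightarrow> pt \<Rightarrow> pt) \<Rightarrow> bool" where
  "treeing S \<longleftrightarrow> (AE x in mu. \<forall>y. (x, y) \<in> orbit_rel S \<longrightarrow> \<not> (\<exists>ws. closed_walk S y ws))"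

definition mp_involutions :: "(nat \<Rightarrow> pt \<Rightarrow> pt) \<Rightarrow> bool" where
  "mp_involutions S \<longleftrightarrow> (\<forall>i. mpres (S i) \<and> (\<forall>x. S i (S i x) = x))"

definition treeable :: "(pt \<times> pt) set \<Rightarrow> bool" where
  "treeable E \<longleftrightarrow> (\<exists>S. mp_involutions S \<and> treeing S \<and> E = orbit_rel S)"

definition sofic_rel :: "(pt \<times> pt) set \<Rightarrow> bool" where
  "sofic_rel E \<longleftrightarrow> (\<exists>T. mp_action T \<and> sofic_action T \<and> E = orbit_rel T)"

end

theory Submission
  imports Defs
begin

text \<open>Fix \<open>r\<close> and record for every point its pattern: which words of bounded length in the first
  \<open>r\<close> involutions agree at the point, and the first \<open>r\<close> digits along these words. Patterns take
  finitely many values, and the measures of the joint values of (pattern at \<open>x\<close>, patterns at the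
  \<open>S i x\<close>) solve a homogeneous linear system with integer coefficients, which says that each \<open>S i\<close>
  is an involution preserving the measure. A real solution of such a system is approximated by
  rational ones with the same support, because an additive map from the reals to the rationals may
  be prescribed freely on a basis of the reals over the rationals. Clearing denominators gives a
  finite set with involutions on which points look like points of \<open>X\<close> one step away. Passing
  to the product with a finite group generated by involutions without short relations destroys all
  short cycles. On the resulting forest-like model the pattern of a point propagates from one-step
  information to the whole ball, exactly as it does on the treeing.

  For a free action of a free group, each generator is cut into countably many partial involutions
  \<open>A \<leftrightarrow> T A\<close> with \<open>A\<close> disjoint from \<open>T A\<close>; non-backtracking walks along the pieces are reduced words.\<close>

section \<open>Rational approximation of real solutions\<close>

text \<open>Additivity preserves every linear relation with integer coefficients, so
  \<open>f\<close> turns real weights obeying such relations into rational ones obeying the same.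
  Each \<open>v\<close> in \<open>V\<close> has only finitely many nonzero coordinates, so rational
  values close enough to the basis elements give values close to \<open>v\<close>.\<close>

lemma rational_additive_approx:
  fixes V :: "real set"
  assumes "finite V" "e > 0"
  obtains f :: "real \<Rightarrow> real" where "\<And>x y. f (x + y) = f x + f y" "f 1 = 1"
    "\<And>v. v \<in> V \<Longrightarrow> f v \<in> \<rat>" "\<And>v. v \<in> V \<Longrightarrow> \<bar>f v - v\<bar> < e"
proof -
  define sc where "sc = (\<lambda>(q::rat) (x::real). of_rat q * x)"
  interpret Q: vector_space sc
    by unfold_locales (auto simp: sc_def algebra_simps of_rat_add of_rat_mult)
  interpret QQ: vector_space_pair sc sc ..
  have ind1: "Q.independent {1}" by (simp add: Q.dependent_single)
  define B where "B = Q.extend_basis {1}"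
  have B: "1 \<in> B" "Q.independent B" "Q.span B = UNIV"
    using Q.extend_basis_superset[OF ind1] Q.independent_extend_basis[OF ind1]
      Q.span_extend_basis[OF ind1] by (auto simp: B_def)
  define rep where "rep = Q.representation B"
  define Z where "Z v = {b. rep v b \<noteq> 0}" for v
  \<comment> \<open>\<open>M\<close> exceeds the sum of the absolute coordinates of each
    \<open>v\<close> in \<open>V\<close>, so an error below \<open>e / M\<close> at every basis
    element gives an error below \<open>e\<close> at \<open>v\<close>. The summand 1 makes the bound
    strict.\<close>
  define M where "M = 1 + (\<Sum>v\<in>V. \<Sum>b\<in>Z v. \<bar>real_of_rat (rep v b)\<bar>)"
  have "M \<ge> 1" unfolding M_def by (simp add: sum_nonneg)
  have "\<exists>q\<in>\<rat>. \<bar>q - b\<bar> < e / M" for b :: real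
  proof -
    have "e / M > 0" using \<open>M \<ge> 1\<close> \<open>e > 0\<close> by simp
    with Rats_dense_in_real[of b "b + e / M"] obtain q where "q \<in> \<rat>" "b < q" "q < b + e / M"
      by auto
    then show ?thesis by (intro bexI[of _ q]) auto
  qed
  then obtain g0 where g0: "\<And>b. g0 b \<in> \<rat>" "\<And>b. \<bar>g0 b - b\<bar> < e / M" by metis
  \<comment> \<open>The basis contains 1, and its value is made exact so that total mass 1 is
    preserved.\<close>
  define g where "g = g0(1 := 1)"
  have g: "g b \<in> \<rat>" "\<bar>g b - b\<bar> < e / M" for b
    using g0[of b] \<open>M \<ge> 1\<close> \<open>e > 0\<close> by (auto simp: g_def)
  define f where "f = QQ.construct B g"
  interpret f: Vector_Spaces.linear sc sc f
    unfolding f_def by (rule QQ.linear_construct[OF B(2)])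
  have fB: "f b = g b" if "b \<in> B" for b
    unfolding f_def by (rule QQ.construct_basis[OF B(2) that])
  have v_eq: "v = (\<Sum>b\<in>Z v. real_of_rat (rep v b) * b)" for v
    using Q.sum_nonzero_representation_eq[OF B(2), of v] B(3) by (simp add: Z_def rep_def sc_def)
  have ZB: "Z v \<subseteq> B" for v
    using Q.representation_ne_zero[of B v] by (auto simp: Z_def rep_def)
  have f_eq: "f v = (\<Sum>b\<in>Z v. real_of_rat (rep v b) * g b)" for v
  proof -
    have "f v = f (\<Sum>b\<in>Z v. sc (rep v b) b)" using v_eq[of v] by (simp add: sc_def)
    also have "\<dots> = (\<Sum>b\<in>Z v. sc (rep v b) (f b))" by (simp add: f.sum f.scale)
    also have "\<dots> = (\<Sum>b\<in>Z v. real_of_rat (rep v b) * g b)"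
      by (intro sum.cong refl) (simp add: sc_def fB[OF subsetD[OF ZB]])
    finally show ?thesis .
  qed
  show ?thesis
  proof (rule that)
    show "f (x + y) = f x + f y" for x y by (rule f.add)
    show "f 1 = 1" using fB[OF B(1)] by (simp add: g_def)
    show "f v \<in> \<rat>" for v unfolding f_eq using g(1) by (intro Rats_sum Rats_mult) auto
    fix v assume v: "v \<in> V"
    let ?c = "\<Sum>b\<in>Z v. \<bar>real_of_rat (rep v b)\<bar>"
    have "\<bar>f v - v\<bar> = \<bar>\<Sum>b\<in>Z v. real_of_rat (rep v b) * (g b - b)\<bar>"
      by (subst (2) v_eq) (simp add: f_eq sum_subtractf algebra_simps)
    also have "\<dots> \<le> (\<Sum>b\<in>Z v. \<bar>real_of_rat (rep v b)\<bar> * \<bar>g b - b\<bar>)"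
      by (rule order_trans[OF sum_abs]) (simp add: abs_mult)
    also have "\<dots> \<le> (\<Sum>b\<in>Z v. \<bar>real_of_rat (rep v b)\<bar> * (e / M))"
      by (intro sum_mono mult_left_mono less_imp_le[OF g(2)]) auto
    also have "\<dots> = ?c * (e / M)" by (rule sum_distrib_right[symmetric])
    also have "\<dots> < M * (e / M)"
    proof (rule mult_strict_right_mono)
      have "?c \<le> (\<Sum>v\<in>V. \<Sum>b\<in>Z v. \<bar>real_of_rat (rep v b)\<bar>)"
        by (rule member_le_sum[OF v]) (auto intro: sum_nonneg assms)
      then show "?c < M" by (simp add: M_def)
      show "0 < e / M" using \<open>M \<ge> 1\<close> \<open>e > 0\<close> by simp
    qed
    also have "\<dots> = e" using \<open>M \<ge> 1\<close> by simp
    finally show "\<bar>f v - v\<bar> < e" .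
  qed
qed

text \<open>The fibres of \<open>a\<close> over \<open>(p, q)\<close> and \<open>(q, p)\<close> have
  the same size, so points with equal position in two enumerations can be exchanged. One fixed
  enumeration per fibre, used in both directions, makes the exchange an involution; on a diagonal
  fibre it is the identity.\<close>

lemma swap_involution_exists:
  fixes a :: "'y \<Rightarrow> 'c \<times> 'c"
  assumes "finite Y"
    and cnt: "\<And>p q. card {y \<in> Y. a y = (p, q)} = card {y \<in> Y. a y = (q, p)}"
  obtains h where "\<And>y. y \<in> Y \<Longrightarrow> h y \<in> Y" "\<And>y. y \<in> Y \<Longrightarrow> h (h y) = y"
    "\<And>y. y \<in> Y \<Longrightarrow> a (h y) = prod.swap (a y)"
proof -
  define C where "C c = {y \<in> Y. a y = c}" for c
  have fin: "finite (C c)" for c using assms(1) by (simp add: C_def)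
  have "\<exists>e. bij_betw e (C c) {0..<card (C c)}" for c
    using ex_bij_betw_finite_nat[OF fin] .
  then obtain e where e: "\<And>c. bij_betw (e c) (C c) {0..<card (C c)}" by metis
  have card: "card (C (prod.swap c)) = card (C c)" for c
    using cnt[of "fst c" "snd c"] by (simp add: C_def prod.swap_def)
  define h where "h y = inv_into (C (prod.swap (a y))) (e (prod.swap (a y))) (e (a y) y)" for y
  have key: "h y \<in> C (prod.swap (a y)) \<and> e (prod.swap (a y)) (h y) = e (a y) y" if "y \<in> Y" for y
  proof -
    have "y \<in> C (a y)" using that by (simp add: C_def)
    then have "e (a y) y \<in> e (prod.swap (a y)) ` C (prod.swap (a y))"
      using e[of "a y"] e[of "prod.swap (a y)"] unfolding bij_betw_def card by blast
    then show ?thesis unfolding h_def by (metis f_inv_into_f inv_into_into)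
  qed
  have hY: "h y \<in> Y" "a (h y) = prod.swap (a y)" if "y \<in> Y" for y
    using key[OF that] by (auto simp: C_def)
  have "h (h y) = y" if y: "y \<in> Y" for y
  proof -
    have "h (h y) \<in> C (a y)" "e (a y) (h (h y)) = e (a y) y"
      using key[OF hY(1)[OF y]] key[OF y] hY(2)[OF y] by auto
    moreover have "y \<in> C (a y)" using y by (simp add: C_def)
    ultimately show ?thesis using e[of "a y"] by (auto simp: bij_betw_def inj_on_def)
  qed
  with hY show ?thesis using that by blast
qed

section \<open>Finite models of one-step statistics\<close>

lemma space_mu [simp]: "space mu = UNIV"
  by (simp add: mu_def space_PiM)

lemma prob_space_mu: "prob_space mu"
  unfolding mu_def by (intro prob_space_PiM prob_space_measure_pmf)

lemma measure_vimage_mpres: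
  assumes "mpres f" "A \<in> sets mu"
  shows "measure mu (f -` A) = measure mu A"
  using assms measure_distr[of f mu mu A] by (auto simp: mpres_def)

lemma vimage_sets_mu:
  assumes "mpres f" "A \<in> sets mu"
  shows "f -` A \<in> sets mu"
  using assms measurable_sets[of f mu mu A] by (auto simp: mpres_def)

lemma common_denominator:
  assumes "finite V" "V \<subseteq> (\<rat> :: real set)"
  obtains D :: nat where "D > 0" "\<And>v. v \<in> V \<Longrightarrow> real D * v \<in> \<int>"
  using assms
proof (induction V arbitrary: thesis rule: finite_induct)
  case empty
  show ?case by (rule empty(1)[of 1]) auto
next
  case (insert v V)
  from insert.prems(2) insert.IH obtain D where D: "D > 0" "\<And>v. v \<in> V \<Longrightarrow> real D * v \<in> \<int>" by auto
  from insert.prems(2) obtain a b :: int where ab: "b > 0" "v = of_int a / of_int b"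
    by (auto elim: Rats_cases')
  show ?case
  proof (rule insert.prems(1)[of "D * nat b"])
    show "0 < D * nat b" using D ab by simp
    fix w assume w: "w \<in> insert v V"
    show "real (D * nat b) * w \<in> \<int>"
    proof (cases "w = v")
      case True
      then have "real (D * nat b) * w = of_int (int D * a)" using ab by simp
      then show ?thesis by (metis Ints_of_int)
    next
      case False
      with w D have "real D * w \<in> \<int>" by auto
      then have "real_of_int b * (real D * w) \<in> \<int>" by (rule Ints_mult[OF Ints_of_int])
      moreover have "real (D * nat b) * w = real_of_int b * (real D * w)" using ab by simp
      ultimately show ?thesis by metis
    qed
  qed
qed

text \<open>\<open>S i\<close> exchanges the event \<tau> = p at \<open>x\<close>, \<tau> = q at
  \<open>S i x\<close> with the one where p and q are swapped, so both have the same measure: an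
  integer relation between the weights of the values of \<open>t\<close>. After rationalising and
  clearing denominators it is an equality of cardinalities, which
  \<open>swap_involution_exists\<close> turns into an involution.\<close>

lemma finite_model:
  fixes S :: "nat \<Rightarrow> pt \<Rightarrow> pt" and \<tau> :: "pt \<Rightarrow> 'c" and r :: nat
  assumes S: "mp_involutions S"
    and \<tau>: "finite (range \<tau>)" "\<And>p. \<tau> -` {p} \<in> sets mu"
    and N: "N \<in> null_sets mu" and "e > 0"
  obtains Y :: "(('c \<times> 'c list) \<times> nat) set" and \<sigma> :: "nat \<Rightarrow> _ \<Rightarrow> _" and L where
    "finite Y" "Y \<noteq> {}" "\<And>y. y \<in> Y \<Longrightarrow> L y \<notin> N"
    "\<And>i y. i < r \<Longrightarrow> y \<in> Y \<Longrightarrow> \<sigma> i y \<in> Y \<and> \<sigma> i (\<sigma> i y) = y \<and> \<tau> (L (\<sigma> i y)) = \<tau> (S i (L y))"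
    "\<And>p. \<bar>real (card {y \<in> Y. \<tau> (L y) = p}) / real (card Y) - measure mu (\<tau> -` {p})\<bar> \<le> e"
proof -
  interpret prob_space mu by (rule prob_space_mu)
  have Sm: "mpres (S i)" and SS [simp]: "S i (S i x) = x" for i x
    using S by (auto simp: mp_involutions_def)
  define t where "t x = (\<tau> x, map (\<lambda>i. \<tau> (S i x)) [0..<r])" for x
  have fint: "finite (range t)"
  proof (rule finite_subset)
    show "range t \<subseteq> range \<tau> \<times> {xs. set xs \<subseteq> range \<tau> \<and> length xs = r}" by (auto simp: t_def)
    show "finite (range \<tau> \<times> {xs. set xs \<subseteq> range \<tau> \<and> length xs = r})"
      by (intro finite_cartesian_product \<tau>(1) finite_lists_length_eq)
  qed
  have t1: "t -` {u} \<in> sets mu" for u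
  proof (cases "length (snd u) = r")
    case True
    then have "t x = u \<longleftrightarrow> \<tau> x = fst u \<and> (\<forall>i<r. \<tau> (S i x) = snd u ! i)" for x
      unfolding t_def prod_eq_iff list_eq_iff_nth_eq by simp
    then have eq: "t -` {u} = \<tau> -` {fst u} \<inter> {x. \<forall>i<r. \<tau> (S i x) = snd u ! i}"
      by auto
    have "{x. \<forall>i<k. \<tau> (S i x) = snd u ! i} \<in> sets mu" for k
    proof (induction k)
      case 0
      show ?case using sets.top[of mu] by simp
    next
      case (Suc k)
      have "{x. \<forall>i<Suc k. \<tau> (S i x) = snd u ! i} =
        S k -` (\<tau> -` {snd u ! k}) \<inter> {x. \<forall>i<k. \<tau> (S i x) = snd u ! i}"
        by (auto simp: less_Suc_eq)
      then show ?case using sets.Int[OF vimage_sets_mu[OF Sm \<tau>(2)] Suc] by simp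
    qed
    then show ?thesis unfolding eq by (intro sets.Int \<tau>(2))
  next
    case False
    then have "t -` {u} = {}" by (auto simp: t_def)
    then show ?thesis by simp
  qed
  define m where "m u = measure mu (t -` {u})" for u
  \<comment> \<open>Null values of \<open>t\<close> are dropped: every remaining fibre meets the
    complement of \<open>N\<close>, and its weight stays positive under a close
    approximation.\<close>
  define K where "K = {u \<in> range t. m u > 0}"
  have finK: "finite K" using fint by (simp add: K_def)
  have msum: "measure mu (t -` U) = (\<Sum>u\<in>U \<inter> K. m u)" for U
  proof -
    have "t -` U = (\<Union>u\<in>U \<inter> range t. t -` {u})"
      by (auto intro: range_eqI[OF sym])
    then have "measure mu (t -` U) = (\<Sum>u\<in>U \<inter> range t. m u)"
      unfolding m_def using finite_measure_finite_Union[of "U \<inter> range t" "\<lambda>u. t -` {u}"] fint t1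
      by (simp add: disjoint_family_on_def image_subset_iff disjoint_iff)
    also have "\<dots> = (\<Sum>u\<in>U \<inter> K. m u)"
      by (rule sum.mono_neutral_right) (use fint in \<open>auto simp: K_def m_def zero_less_measure_iff\<close>)
    finally show ?thesis .
  qed
  have K1: "(\<Sum>u\<in>K. m u) = 1" using msum[of UNIV] prob_space by simp
  then have "K \<noteq> {}" by auto
  \<comment> \<open>The first bound keeps each \<open>f (m u)\<close> positive; the second makes the
    errors over all of \<open>K\<close> add up to at most \<open>e\<close>.\<close>
  define e' where "e' = min (Min (m ` K)) (e / real (card K))"
  have "card K > 0" using finK \<open>K \<noteq> {}\<close> by (simp add: card_gt_0_iff)
  have "e' > 0" using \<open>card K > 0\<close> \<open>e > 0\<close> finK \<open>K \<noteq> {}\<close> by (auto simp: e'_def K_def)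
  obtain f :: "real \<Rightarrow> real" where f: "\<And>x y. f (x + y) = f x + f y" "f 1 = 1"
    "\<And>v. v \<in> m ` K \<Longrightarrow> f v \<in> \<rat>" "\<And>v. v \<in> m ` K \<Longrightarrow> \<bar>f v - v\<bar> < e'"
    using rational_additive_approx[of "m ` K" e'] finK \<open>e' > 0\<close> by blast
  have f0: "f 0 = 0" using f(1)[of 0 0] by simp
  have fsum: "f (\<Sum>u\<in>U. m u) = (\<Sum>u\<in>U. f (m u))" for U
    by (induction U rule: infinite_finite_induct) (auto simp: f0 f(1))
  have fpos: "f (m u) > 0" if "u \<in> K" for u
  proof -
    have "e' \<le> m u" using that finK by (auto simp: e'_def intro: min.coboundedI1)
    with f(4)[of "m u"] that show ?thesis by auto
  qed
  obtain D where D: "D > 0" "\<And>v. v \<in> (\<lambda>u. f (m u)) ` K \<Longrightarrow> real D * v \<in> \<int>"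
    using common_denominator[of "(\<lambda>u. f (m u)) ` K"] f(3) finK by auto
  \<comment> \<open>The number of copies of \<open>u\<close> in the model. For \<open>u\<close> in
    \<open>K\<close> the product is already a nonnegative integer, so floor and \<open>nat\<close>
    only change the type.\<close>
  define n where "n u = nat \<lfloor>real D * f (m u)\<rfloor>" for u
  have n: "real (n u) = real D * f (m u)" if "u \<in> K" for u
  proof -
    have "real D * f (m u) \<in> \<int>" using D(2) that by auto
    moreover have "real D * f (m u) \<ge> 0" using fpos[OF that] by simp
    ultimately show ?thesis by (auto simp: n_def elim!: Ints_cases)
  qed
  define Y where "Y = (SIGMA u:K. {..<n u})"
  have finY: "finite Y" using finK by (auto simp: Y_def)
  \<comment> \<open>Stated for every set of values \<open>U\<close>, so that equal measures yield
    equal cardinalities.\<close>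
  have cardY: "real (card {y \<in> Y. fst y \<in> U}) = real D * f (measure mu (t -` U))" for U
  proof -
    have "{y \<in> Y. fst y \<in> U} = (SIGMA u:U \<inter> K. {..<n u})" by (auto simp: Y_def)
    then have "real (card {y \<in> Y. fst y \<in> U}) = (\<Sum>u\<in>U \<inter> K. real (n u))"
      using finK by simp
    also have "\<dots> = real D * (\<Sum>u\<in>U \<inter> K. f (m u))" by (simp add: n sum_distrib_left)
    finally show ?thesis by (simp add: msum fsum)
  qed
  have cY: "card Y = D" using cardY[of UNIV] f(2) prob_space by simp
  define L where "L y = (SOME x. x \<notin> N \<and> t x = fst y)" for y :: "('c \<times> 'c list) \<times> nat"
  have L: "L y \<notin> N \<and> t (L y) = fst y" if "y \<in> Y" for y
  proof -
    have "\<exists>x. x \<notin> N \<and> t x = fst y"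
    proof (rule ccontr)
      assume "\<nexists>x. x \<notin> N \<and> t x = fst y"
      then have "t -` {fst y} \<subseteq> N" by auto
      then have "t -` {fst y} \<in> null_sets mu" by (rule null_sets_subset[OF N t1])
      then have "m (fst y) = 0" by (simp add: m_def null_sets_def measure_def)
      with that show False by (auto simp: Y_def K_def)
    qed
    then show ?thesis unfolding L_def by (rule someI_ex)
  qed
  have Lt: "\<tau> (L y) = fst (fst y)" "i < r \<Longrightarrow> \<tau> (S i (L y)) = snd (fst y) ! i" if "y \<in> Y" for y i
    using L[OF that] by (auto simp: t_def dest!: sym[of _ "fst y"])
  define a where "a i y = (\<tau> (L y), \<tau> (S i (L y)))" for i and y :: "('c \<times> 'c list) \<times> nat"
  have cnt: "card {y \<in> Y. a i y = (p, q)} = card {y \<in> Y. a i y = (q, p)}" if i: "i < r" for i p q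
  proof -
    define U where "U p q = {u :: 'c \<times> 'c list. fst u = p \<and> snd u ! i = q}" for p q
    have *: "{y \<in> Y. a i y = (p, q)} = {y \<in> Y. fst y \<in> U p q}" for p q
      using i by (auto simp: a_def U_def Lt)
    have tU: "t -` U p q = {x. \<tau> x = p \<and> \<tau> (S i x) = q}" for p q
      using i by (auto simp: t_def U_def)
    have U': "t -` U p q \<in> sets mu" for p q
    proof -
      have "t -` U p q = \<tau> -` {p} \<inter> S i -` (\<tau> -` {q})" by (auto simp: tU)
      then show ?thesis using \<tau>(2) vimage_sets_mu[OF Sm \<tau>(2)] by simp
    qed
    have "t -` U p q = S i -` (t -` U q p)" by (auto simp: tU)
    then have "measure mu (t -` U p q) = measure mu (t -` U q p)"
      using measure_vimage_mpres[OF Sm U'] by simp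
    then have "real (card {y \<in> Y. a i y = (p, q)}) = real (card {y \<in> Y. a i y = (q, p)})"
      unfolding * cardY by simp
    then show ?thesis by simp
  qed
  have "\<exists>h. i < r \<longrightarrow> (\<forall>y\<in>Y. h y \<in> Y \<and> h (h y) = y \<and> a i (h y) = prod.swap (a i y))" for i
    using swap_involution_exists[OF finY cnt] by metis
  then obtain \<sigma> where \<sigma>: "\<And>i y. i < r \<Longrightarrow> y \<in> Y \<Longrightarrow>
    \<sigma> i y \<in> Y \<and> \<sigma> i (\<sigma> i y) = y \<and> a i (\<sigma> i y) = prod.swap (a i y)" by metis
  show ?thesis
  proof (rule that)
    show "finite Y" by (rule finY)
    show "Y \<noteq> {}" using cY D by auto
    show "L y \<notin> N" if "y \<in> Y" for y using L that by auto
    show "\<sigma> i y \<in> Y \<and> \<sigma> i (\<sigma> i y) = y \<and> \<tau> (L (\<sigma> i y)) = \<tau> (S i (L y))" if "i < r" "y \<in> Y" for i y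
      using \<sigma>[OF that] by (auto simp: a_def)
    fix p
    define U where "U = {u :: 'c \<times> 'c list. fst u = p}"
    have "{y \<in> Y. \<tau> (L y) = p} = {y \<in> Y. fst y \<in> U}" by (auto simp: U_def Lt)
    then have "real (card {y \<in> Y. \<tau> (L y) = p}) / real (card Y) = f (measure mu (t -` U))"
      using cardY D by (simp add: cY)
    moreover have "\<tau> -` {p} = t -` U" by (auto simp: t_def U_def)
    moreover have "\<bar>f (measure mu (t -` U)) - measure mu (t -` U)\<bar> \<le> e"
    proof -
      have "\<bar>f (measure mu (t -` U)) - measure mu (t -` U)\<bar> = \<bar>\<Sum>u\<in>U \<inter> K. f (m u) - m u\<bar>"
        by (simp add: msum fsum sum_subtractf)
      also have "\<dots> \<le> (\<Sum>u\<in>U \<inter> K. \<bar>f (m u) - m u\<bar>)" by (rule sum_abs)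
      also have "\<dots> \<le> (\<Sum>u\<in>U \<inter> K. e')" by (intro sum_mono less_imp_le f(4)) auto
      also have "\<dots> \<le> (\<Sum>u\<in>K. e')" using \<open>e' > 0\<close> finK by (intro sum_mono2) auto
      also have "\<dots> \<le> real (card K) * (e / real (card K))"
        unfolding sum_constant e'_def by (intro mult_left_mono) auto
      finally show ?thesis using \<open>card K > 0\<close> by simp
    qed
    ultimately show "\<bar>real (card {y \<in> Y. \<tau> (L y) = p}) / real (card Y) - measure mu (\<tau> -` {p})\<bar> \<le> e"
      by simp
  qed
qed

section \<open>Words, patterns and balls\<close>

definition short_words :: "nat \<Rightarrow> nat \<Rightarrow> nat list set" where
  "short_words r n = {w. set w \<subseteq> {..<r} \<and> length w \<le> n}"

lemma finite_short_words: "finite (short_words r n)"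
  unfolding short_words_def by (intro finite_lists_length_le) simp

definition involutive_on :: "'a set \<Rightarrow> nat \<Rightarrow> (nat \<Rightarrow> 'a \<Rightarrow> 'a) \<Rightarrow> bool" where
  "involutive_on A r T \<longleftrightarrow> (\<forall>i<r. \<forall>a\<in>A. T i a \<in> A \<and> T i (T i a) = a)"

lemma involutive_onD:
  "involutive_on A r T \<Longrightarrow> i < r \<Longrightarrow> a \<in> A \<Longrightarrow> T i a \<in> A"
  "involutive_on A r T \<Longrightarrow> i < r \<Longrightarrow> a \<in> A \<Longrightarrow> T i (T i a) = a"
  by (auto simp: involutive_on_def)

lemma involutive_on_mono: "involutive_on A r T \<Longrightarrow> s \<le> r \<Longrightarrow> involutive_on A s T"
  by (auto simp: involutive_on_def)

lemma fold_in_carrier: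
  assumes "involutive_on A r T" "set w \<subseteq> {..<r}" "a \<in> A"
  shows "fold T w a \<in> A"
  using assms(2,3) by (induction w arbitrary: a) (auto simp: involutive_onD[OF assms(1)])

lemma fold_rev_cancel:
  assumes "involutive_on A r T" "set w \<subseteq> {..<r}" "a \<in> A"
  shows "fold T (rev w) (fold T w a) = a"
  using assms(2,3) by (induction w arbitrary: a) (auto simp: involutive_onD[OF assms(1)])

text \<open>An involution is its own inverse, so both signs of a letter act alike and words in
  letters can be replaced by words in indices.\<close>

lemma act_letter_involutive:
  assumes "involutive_on A r T" "fst l < r" "a \<in> A"
  shows "act_letter A T l a = T (fst l) a"
proof -
  have "inj_on (T (fst l)) A"
    using assms by (intro inj_on_inverseI[where g = "T (fst l)"]) (auto simp: involutive_onD)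
  then show ?thesis
    using assms by (auto simp: act_letter_def involutive_onD intro!: inv_into_f_eq)
qed

text \<open>\<open>act_word\<close> applies the last letter first and \<open>fold\<close> the first
  one, hence the reversal.\<close>

lemma act_word_involutive:
  assumes "involutive_on A r T" "\<forall>l\<in>set w. fst l < r" "a \<in> A"
  shows "act_word A T w a = fold T (rev (map fst w)) a"
  using assms(2)
proof (induction w)
  case (Cons l w)
  have "set (rev (map fst w)) \<subseteq> {..<r}" using Cons.prems by auto
  from fold_in_carrier[OF assms(1) this assms(3)] Cons assms(1) show ?case
    by (simp add: act_word_def act_letter_involutive)
qed (simp add: act_word_def)

text \<open>The two points may live in different systems, so that a model can be compared with X.
  The length bound \<open>n\<close> is separate from \<open>r\<close> because it drops with each
  step taken, while the generators and digits in view stay the same.\<close>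

definition same_pattern ::
  "nat \<Rightarrow> nat \<Rightarrow> (nat \<Rightarrow> 'a \<Rightarrow> 'a) \<Rightarrow> ('a \<Rightarrow> pt) \<Rightarrow> 'a \<Rightarrow> (nat \<Rightarrow> 'b \<Rightarrow> 'b) \<Rightarrow> ('b \<Rightarrow> pt) \<Rightarrow> 'b \<Rightarrow> bool"
  where
  "same_pattern n r T L x U M y \<longleftrightarrow>
    (\<forall>v\<in>short_words r n. \<forall>v'\<in>short_words r n. (fold T v x = fold T v' x) = (fold U v y = fold U v' y)) \<and>
    (\<forall>v\<in>short_words r n. \<forall>k<r. L (fold T v x) k = M (fold U v y) k)"

lemma same_pattern_sym: "same_pattern n r T L x U M y \<Longrightarrow> same_pattern n r U M y T L x"
  by (auto simp: same_pattern_def)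

lemma same_pattern_trans:
  "same_pattern n r T L x U M y \<Longrightarrow> same_pattern n r U M y R K z \<Longrightarrow> same_pattern n r T L x R K z"
  by (auto simp: same_pattern_def)

lemma same_pattern_mono: "same_pattern n r T L x U M y \<Longrightarrow> m \<le> n \<Longrightarrow> same_pattern m r T L x U M y"
  unfolding same_pattern_def by (simp add: short_words_def)

text \<open>A word \<open>v\<close> read at \<open>T i x\<close> is \<open>i # v\<close> read at
  \<open>x\<close>, which costs one unit of length.\<close>

lemma same_pattern_step:
  assumes "same_pattern (Suc n) r T L x U M y" "i < r"
  shows "same_pattern n r T L (T i x) U M (U i y)"
proof -
  have i: "i # v \<in> short_words r (Suc n)" if "v \<in> short_words r n" for v using that assms(2) by (auto simp: short_words_def)
  have "(fold T (i # v) x = fold T (i # v') x) = (fold U (i # v) y = fold U (i # v') y)"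
    if "v \<in> short_words r n" "v' \<in> short_words r n" for v v'
    using assms(1) i[OF that(1)] i[OF that(2)] unfolding same_pattern_def by blast
  moreover have "L (fold T (i # v) x) k = M (fold U (i # v) y) k" if "v \<in> short_words r n" "k < r" for v k
    using assms(1) i[OF that(1)] that(2) unfolding same_pattern_def by blast
  ultimately show ?thesis by (simp add: same_pattern_def)
qed

lemma same_pattern_fix:
  assumes "same_pattern (Suc n) r T L x U M y" "i < r"
  shows "T i x = x \<longleftrightarrow> U i y = y"
proof -
  have "[i] \<in> short_words r (Suc n)" "[] \<in> short_words r (Suc n)" using assms(2) by (auto simp: short_words_def)
  then have "(fold T [i] x = fold T [] x) = (fold U [i] y = fold U [] y)"
    using assms(1) unfolding same_pattern_def by blast
  then show ?thesis by simp
qed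

text \<open>Vertices are endpoints of words of length at most \<open>s\<close>, and an edge asks
  whether such a word with one more letter ends at another vertex. Coincidences of words up to
  length \<open>Suc r\<close> therefore determine the ball.\<close>

lemma ball_iso:
  assumes T: "involutive_on A r T" and U: "involutive_on B r U"
    and xy: "x \<in> A" "y \<in> B" and pat: "same_pattern (Suc r) r T L x U M y" and "s \<le> r"
  shows "rg_iso (ball s A T L x) (ball s B U M y)"
proof -
  define Q where "Q = (\<lambda>w. rev (map fst w)) ` W s"
  have Q: "set v \<subseteq> {..<s} \<and> length v \<le> s" if "v \<in> Q" for v using that by (auto simp: Q_def W_def)
  then have Qw: "v \<in> short_words r (Suc r)" "i < s \<Longrightarrow> v @ [i] \<in> short_words r (Suc r)" if "v \<in> Q" for v i
    using that \<open>s \<le> r\<close> by (fastforce simp: short_words_def)+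
  have Ts: "involutive_on A s T" and Us: "involutive_on B s U"
    using T U \<open>s \<le> r\<close> by (auto intro: involutive_on_mono)
  have VT: "(\<lambda>w. act_word A T w x) ` W s = (\<lambda>v. fold T v x) ` Q"
    unfolding Q_def image_image using act_word_involutive[OF Ts _ xy(1)]
    by (intro image_cong) (auto simp: W_def)
  have VU: "(\<lambda>w. act_word B U w y) ` W s = (\<lambda>v. fold U v y) ` Q"
    unfolding Q_def image_image using act_word_involutive[OF Us _ xy(2)]
    by (intro image_cong) (auto simp: W_def)
  have eq: "fold T v x = fold T v' x \<longleftrightarrow> fold U v y = fold U v' y"
    if "v \<in> short_words r (Suc r)" "v' \<in> short_words r (Suc r)" for v v'
    using pat that by (auto simp: same_pattern_def)
  define f where "f z = fold U (SOME v. v \<in> Q \<and> fold T v x = z) y" for z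
  have f: "f (fold T v x) = fold U v y" if "v \<in> Q" for v
  proof -
    have "(SOME v'. v' \<in> Q \<and> fold T v' x = fold T v x) \<in> Q \<and>
        fold T (SOME v'. v' \<in> Q \<and> fold T v' x = fold T v x) x = fold T v x"
      by (rule someI[of _ v]) (use that in auto)
    then show ?thesis unfolding f_def using eq[OF Qw(1) Qw(1)] that by blast
  qed
  have inA: "fold T v x \<in> A" and inB: "fold U v y \<in> B" if "v \<in> Q" for v
    using Q[OF that] fold_in_carrier[OF Ts _ xy(1)] fold_in_carrier[OF Us _ xy(2)] by auto
  have "[] \<in> Q" by (auto simp: Q_def W_def image_iff intro!: exI[of _ "[]"])
  have step: "T i (fold T v x) \<in> (\<lambda>v. fold T v x) ` Q \<longleftrightarrow> U i (fold U v y) \<in> (\<lambda>v. fold U v y) ` Q"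
    and fstep: "T i (fold T v x) \<in> (\<lambda>v. fold T v x) ` Q \<Longrightarrow> f (T i (fold T v x)) = U i (fold U v y)"
    if "v \<in> Q" "i < s" for v i
  proof -
    have *: "T i (fold T v x) = fold T v' x \<longleftrightarrow> U i (fold U v y) = fold U v' y" if "v' \<in> Q" for v'
      using eq[OF Qw(2)[OF \<open>v \<in> Q\<close> \<open>i < s\<close>] Qw(1)[OF that]] by simp
    then show "T i (fold T v x) \<in> (\<lambda>v. fold T v x) ` Q \<longleftrightarrow> U i (fold U v y) \<in> (\<lambda>v. fold U v y) ` Q"
      by auto
    show "f (T i (fold T v x)) = U i (fold U v y)" if "T i (fold T v x) \<in> (\<lambda>v. fold T v x) ` Q"
    proof -
      from that obtain v' where v': "v' \<in> Q" "T i (fold T v x) = fold T v' x" by auto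
      with *[OF v'(1)] f[OF v'(1)] show ?thesis by simp
    qed
  qed
  show ?thesis
    unfolding rg_iso_def
  proof (intro exI[of _ f] conjI)
    show "bij_betw f (verts (ball s A T L x)) (verts (ball s B U M y))"
      unfolding bij_betw_def
    proof
      show "inj_on f (verts (ball s A T L x))"
        by (auto simp: ball_def Let_def VT inj_on_def f eq[OF Qw(1) Qw(1)])
      show "f ` verts (ball s A T L x) = verts (ball s B U M y)"
        by (force simp: ball_def Let_def VT VU f image_image)
    qed
    show "f (root (ball s A T L x)) = root (ball s B U M y)"
      using f[OF \<open>[] \<in> Q\<close>] by (simp add: ball_def Let_def)
    show "\<forall>v\<in>verts (ball s A T L x). vlab (ball s B U M y) (f v) = vlab (ball s A T L x) v \<and>
      (\<forall>l. edge (ball s B U M y) (f v) l = map_option f (edge (ball s A T L x) v l))"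
    proof
      fix z assume "z \<in> verts (ball s A T L x)"
      then obtain v where v: "v \<in> Q" "z = fold T v x" by (auto simp: ball_def Let_def VT)
      have "vlab (ball s B U M y) (f z) = vlab (ball s A T L x) z"
        using pat Qw(1)[OF v(1)] \<open>s \<le> r\<close> by (simp add: ball_def Let_def v f same_pattern_def)
      moreover have "edge (ball s B U M y) (f z) l = map_option f (edge (ball s A T L x) z l)" for l
      proof (cases "fst l < s")
        case True
        then show ?thesis
          using v(1) step[OF v(1) True] fstep[OF v(1) True] inA[OF v(1)] inB[OF v(1)]
          by (auto simp: ball_def Let_def VT VU v(2) f act_letter_involutive[OF Ts True]
            act_letter_involutive[OF Us True])
      qed (simp add: ball_def Let_def)
      ultimately show "vlab (ball s B U M y) (f z) = vlab (ball s A T L x) z \<and>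
        (\<forall>l. edge (ball s B U M y) (f z) l = map_option f (edge (ball s A T L x) z l))" by blast
    qed
  qed
qed

lemma rg_iso_trans:
  assumes "rg_iso G H" "rg_iso H K" shows "rg_iso G K"
proof -
  from assms obtain f g where f: "bij_betw f (verts G) (verts H)" "f (root G) = root H"
      "\<forall>v\<in>verts G. vlab H (f v) = vlab G v \<and> (\<forall>l. edge H (f v) l = map_option f (edge G v l))"
    and g: "bij_betw g (verts H) (verts K)" "g (root H) = root K"
      "\<forall>v\<in>verts H. vlab K (g v) = vlab H v \<and> (\<forall>l. edge K (g v) l = map_option g (edge H v l))"
    unfolding rg_iso_def by auto
  show ?thesis unfolding rg_iso_def
  proof (intro exI[of _ "g \<circ> f"] conjI ballI)
    show "bij_betw (g \<circ> f) (verts G) (verts K)" using f(1) g(1) by (rule bij_betw_trans)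
    show "(g \<circ> f) (root G) = root K" by (simp add: f g)
    fix v assume v: "v \<in> verts G"
    then have "f v \<in> verts H" using f(1) by (auto simp: bij_betw_def)
    with v show "vlab K ((g \<circ> f) v) = vlab G v"
      "\<forall>l. edge K ((g \<circ> f) v) l = map_option (g \<circ> f) (edge G v l)"
      using f(3) g(3) by (simp_all add: option.map_comp)
  qed
qed

section \<open>Finite sets with involutions and no short cycles\<close>

text \<open>The words without equal neighbours form a tree, truncated at length \<open>n\<close>, on
  which \<open>h i\<close> crosses the edge labelled \<open>i\<close>. A nonempty word of this kind
  moves the root, and composing with permutations of the tree from the left spreads this to every
  point of \<open>G\<close>.\<close>

lemma large_girth_involutions:
  obtains G :: "(nat list \<Rightarrow> nat list) set" and g where
    "finite G" "G \<noteq> {}" "involutive_on G r g"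
    "\<And>w p. w \<in> short_words r n \<Longrightarrow> w \<noteq> [] \<Longrightarrow> distinct_adj w \<Longrightarrow> p \<in> G \<Longrightarrow> fold g w p \<noteq> p"
proof -
  define B where "B = {u \<in> short_words r n. distinct_adj u}"
  have finB: "finite B" unfolding B_def using finite_short_words by simp
  \<comment> \<open>A word of length \<open>n\<close> with a head other than \<open>i\<close> is a
    leaf without an edge labelled \<open>i\<close> and stays fixed. Fixing also everything outside
    \<open>B\<close> makes \<open>h i\<close> a permutation of \<open>B\<close>.\<close>
  define h where "h i u = (if u \<notin> B \<or> i \<ge> r then u else if u \<noteq> [] \<and> hd u = i then tl u
     else if length u < n then i # u else u)" for i u
  have tlB: "tl u \<in> B" if "u \<in> B" for u
    using that by (cases u) (auto simp: B_def short_words_def distinct_adj_Cons)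
  have consB: "i # u \<in> B" if "u \<in> B" "i < r" "length u < n" "u = [] \<or> hd u \<noteq> i" for i u
    using that by (auto simp: B_def short_words_def distinct_adj_Cons)
  have hB: "h i u \<in> B" if "u \<in> B" for i u
    using that tlB consB by (auto simp: h_def not_le)
  have hh: "h i (h i u) = u" for i u
  proof (cases "u \<notin> B \<or> i \<ge> r")
    case False
    then have u: "u \<in> B" "i < r" by auto
    consider v where "u = i # v" | "u = [] \<or> hd u \<noteq> i" "length u < n" | "u = [] \<or> hd u \<noteq> i" "length u \<ge> n"
      by (cases u) force+
    then show ?thesis
    proof cases
      case 1
      then have "v = [] \<or> hd v \<noteq> i" "length v < n" "v \<in> B"
        using u tlB[OF u(1)] by (auto simp: B_def short_words_def distinct_adj_Cons)
      then show ?thesis using u 1 by (auto simp: h_def)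
    next
      case 2
      then show ?thesis using u consB[OF u] by (auto simp: h_def)
    qed (use u in \<open>auto simp: h_def\<close>)
  qed (auto simp: h_def)
  have hperm: "h i permutes B" for i
    unfolding permutes_def by (metis h_def hh)
  define G where "G = {p. p permutes B}"
  define g where "g i p = h i \<circ> p" for i and p :: "nat list \<Rightarrow> nat list"
  have fold_g: "fold g w p = fold h w \<circ> p" for w p
    by (induction w arbitrary: p) (auto simp: g_def)
  \<comment> \<open>Letters pile up at the head, hence \<open>rev\<close>; the length bound keeps
    the walk from being stopped at a leaf.\<close>
  have walk: "fold h w u = rev w @ u"
    if "set w \<subseteq> {..<r}" "distinct_adj (rev w @ u)" "length w + length u \<le> n" "set u \<subseteq> {..<r}" for w u
    using that
  proof (induction w arbitrary: u)
    case (Cons i w)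
    have d: "distinct_adj (i # u)" using Cons.prems(2) by (simp add: distinct_adj_append_iff)
    then have "u \<in> B" "u = [] \<or> hd u \<noteq> i"
      using Cons.prems by (auto simp: B_def short_words_def distinct_adj_Cons)
    then have "h i u = i # u" using Cons.prems by (auto simp: h_def)
    with Cons.IH[of "i # u"] Cons.prems show ?case by simp
  qed simp
  show ?thesis
  proof (rule that[of G g])
    show "finite G" unfolding G_def by (rule finite_permutations[OF finB])
    show "G \<noteq> {}" using permutes_id[of B] by (auto simp: G_def simp del: permutes_id)
    show "involutive_on G r g"
      by (auto simp: involutive_on_def G_def g_def hh fun_eq_iff intro: permutes_compose[OF _ hperm])
    fix w p assume w: "w \<in> short_words r n" "w \<noteq> []" "distinct_adj w" and p: "p \<in> G"
    show "fold g w p \<noteq> p"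
    proof
      assume "fold g w p = p"
      \<comment> \<open>Evaluation at the preimage of the empty word turns a fixed permutation into
        a fixed root.\<close>
      then have "fold h w (p (inv p [])) = p (inv p [])" by (metis fold_g comp_apply)
      moreover have "p (inv p []) = []" using p by (auto simp: G_def permutes_inverses)
      ultimately show False using walk[of w "[]"] w by (auto simp: short_words_def)
    qed
  qed
qed

section \<open>Non-backtracking walks and the propagation of patterns\<close>

text \<open>Only the repetition of an index counts as backtracking. For involutions, two different
  indices joining the same pair of distinct points thus give a closed walk of length 2, so double
  edges count as cycles.\<close>

definition nb_walk :: "(nat \<Rightarrow> 'a \<Rightarrow> 'a) \<Rightarrow> 'a \<Rightarrow> nat list \<Rightarrow> bool" where
  "nb_walk T x w \<longleftrightarrow> distinct_adj w \<and>
    (\<forall>j<length w. T (w ! j) (fold T (take j w) x) \<noteq> fold T (take j w) x)"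

lemma closed_walk_iff: "closed_walk S x w \<longleftrightarrow> w \<noteq> [] \<and> nb_walk S x w \<and> fold S w x = x"
  by (auto simp: closed_walk_def nb_walk_def distinct_adj_conv_nth)

text \<open>Deleting fixed steps and immediate backtracks reduces every word, simultaneously in both
  systems, to a non-backtracking walk, which is never closed unless it is empty.\<close>
lemma same_pattern_of_local_equivariance:
  fixes S :: "nat \<Rightarrow> 'a \<Rightarrow> 'a" and M :: "'a \<Rightarrow> pt" and L :: "'b \<Rightarrow> 'a"
  assumes S: "involutive_on UNIV r S" and U: "involutive_on Y r U"
    and step: "\<And>i y. i < r \<Longrightarrow> y \<in> Y \<Longrightarrow> same_pattern n r S M (L (U i y)) S M (S i (L y))"
    and stab: "\<And>i y. i < r \<Longrightarrow> y \<in> Y \<Longrightarrow> U i y = y \<longleftrightarrow> S i (L y) = L y"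
    and freeS: "\<And>w. w \<noteq> [] \<Longrightarrow> nb_walk S (L y) w \<Longrightarrow> fold S w (L y) \<noteq> L y"
    and freeU: "\<And>w. w \<noteq> [] \<Longrightarrow> w \<in> short_words r n \<Longrightarrow> nb_walk U y w \<Longrightarrow> fold U w y \<noteq> y"
    and y: "y \<in> Y" and m: "2 * m \<le> n"
  shows "same_pattern m r S M (L y) U (\<lambda>z. M (L z)) y"
proof -
  \<comment> \<open>\<open>L\<close> intertwines \<open>U\<close> and \<open>S\<close> only up to
    patterns. Each step costs one unit of length, so after \<open>w\<close> a pattern of length
    \<open>n\<close> minus the length of \<open>w\<close> is still controlled.\<close>
  have pat: "same_pattern k r S M (L (fold U w y)) S M (fold S w (L y))"
    if "w \<in> short_words r n" "length w + k \<le> n" for w k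
    using that
  proof (induction w arbitrary: k rule: rev_induct)
    case Nil
    then show ?case by (simp add: same_pattern_def)
  next
    case (snoc i w)
    then have w: "w \<in> short_words r n" "set w \<subseteq> {..<r}" "i < r" by (auto simp: short_words_def)
    have "same_pattern (Suc k) r S M (L (fold U w y)) S M (fold S w (L y))"
      using snoc w by auto
    from same_pattern_step[OF this w(3)]
    have "same_pattern k r S M (S i (L (fold U w y))) S M (S i (fold S w (L y)))" .
    moreover have "same_pattern k r S M (L (U i (fold U w y))) S M (S i (L (fold U w y)))"
      using same_pattern_mono[OF step[OF w(3) fold_in_carrier[OF U w(2) y]], of k] snoc.prems by simp
    ultimately show ?case using same_pattern_trans by fastforce
  qed
  \<comment> \<open>A remaining pattern of length 1 decides whether the next step is
    stationary.\<close>
  have fixes_iff: "U i (fold U w y) = fold U w y \<longleftrightarrow> S i (fold S w (L y)) = fold S w (L y)"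
    if "w \<in> short_words r n" "i < r" "length w < n" for w i
  proof -
    have "set w \<subseteq> {..<r}" using that by (auto simp: short_words_def)
    then have "U i (fold U w y) = fold U w y \<longleftrightarrow> S i (L (fold U w y)) = L (fold U w y)"
      using stab[OF that(2) fold_in_carrier[OF U _ y]] by simp
    also have "\<dots> \<longleftrightarrow> S i (fold S w (L y)) = fold S w (L y)"
      using same_pattern_fix[OF pat[of w "Suc 0"] that(2)] that by simp
    finally show ?thesis .
  qed
  have closed_iff: "fold S w (L y) = L y \<longleftrightarrow> fold U w y = y" if "w \<in> short_words r n" for w
    using that
  proof (induction "length w" arbitrary: w rule: less_induct)
    case less
    then have w: "set w \<subseteq> {..<r}" "length w \<le> n" by (auto simp: short_words_def)
    consider "w = []" | "w \<noteq> []" "nb_walk S (L y) w" "nb_walk U y w"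
      | u i v where "w = u @ i # v" "S i (fold S u (L y)) = fold S u (L y)"
      | u i v where "w = u @ i # i # v"
    proof (cases "distinct_adj w")
      case False
      then obtain j where j: "Suc j < length w" "w ! j = w ! Suc j"
        by (auto simp: distinct_adj_conv_nth)
      then have "w = take j w @ w ! j # w ! j # drop (Suc (Suc j)) w"
        by (metis Cons_nth_drop_Suc Suc_lessD append_take_drop_id)
      then show ?thesis using that(4) by blast
    next
      case True
      have iff: "U (w ! j) (fold U (take j w) y) = fold U (take j w) y \<longleftrightarrow>
        S (w ! j) (fold S (take j w) (L y)) = fold S (take j w) (L y)" if "j < length w" for j
      proof (rule fixes_iff)
        show "take j w \<in> short_words r n" using w set_take_subset[of j w] by (auto simp: short_words_def)
        show "w ! j < r" using w(1) that nth_mem by blast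
        show "length (take j w) < n" using that w(2) by simp
      qed
      show ?thesis
      proof (cases "nb_walk S (L y) w")
        case True
        then have "nb_walk U y w" using iff by (simp add: nb_walk_def)
        with True that(1,2) show ?thesis by blast
      next
        case False
        then obtain j where j: "j < length w"
          "S (w ! j) (fold S (take j w) (L y)) = fold S (take j w) (L y)"
          using \<open>distinct_adj w\<close> by (auto simp: nb_walk_def)
        then show ?thesis using that(3)[of "take j w" "w ! j" "drop (Suc j) w"]
          by (simp add: id_take_nth_drop[symmetric])
      qed
    qed
    then show ?case
    proof cases
      case 2
      with freeS freeU less.prems show ?thesis by blast
    next
      case (3 u i v)
      with w have u: "u \<in> short_words r n" "i < r" "length u < n" "u @ v \<in> short_words r n"
        by (auto simp: short_words_def)
      with fixes_iff 3(2) have "U i (fold U u y) = fold U u y" by blast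
      with 3 less.hyps[OF _ u(4)] show ?thesis by simp
    next
      case (4 u i v)
      with w have u: "set u \<subseteq> {..<r}" "i < r" "u @ v \<in> short_words r n"
        by (auto simp: short_words_def)
      have "U i (U i (fold U u y)) = fold U u y" "S i (S i (fold S u (L y))) = fold S u (L y)"
        using u fold_in_carrier[OF U u(1) y] U S by (auto simp: involutive_onD)
      with 4 less.hyps[OF _ u(3)] show ?thesis by simp
    qed simp
  qed
  \<comment> \<open>Two words end at the same point exactly when one followed by the other reversed
    is closed; this doubles the length and explains \<open>2 * m\<close>.\<close>
  have cancel: "fold T v z = fold T v' z \<longleftrightarrow> fold T (v @ rev v') z = z"
    if "involutive_on A r T" "z \<in> A" "v \<in> short_words r m" "v' \<in> short_words r m"
    for A and T :: "nat \<Rightarrow> 'c \<Rightarrow> 'c" and z v v'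
  proof
    have v: "set v \<subseteq> {..<r}" "set v' \<subseteq> {..<r}" using that by (auto simp: short_words_def)
    show "fold T (v @ rev v') z = z" if "fold T v z = fold T v' z"
      using fold_rev_cancel[OF \<open>involutive_on A r T\<close> v(2) \<open>z \<in> A\<close>] that by simp
    assume "fold T (v @ rev v') z = z"
    then have "fold T v' (fold T (rev v') (fold T v z)) = fold T v' z" by simp
    then show "fold T v z = fold T v' z"
      using fold_rev_cancel[OF that(1), of "rev v'" "fold T v z"] v
        fold_in_carrier[OF that(1) v(1) that(2)] by simp
  qed
  have "(fold S v (L y) = fold S v' (L y)) = (fold U v y = fold U v' y)"
    if "v \<in> short_words r m" "v' \<in> short_words r m" for v v'
  proof -
    have "v @ rev v' \<in> short_words r n" using that m by (auto simp: short_words_def)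
    from closed_iff[OF this] cancel[OF S UNIV_I that] cancel[OF U y that] show ?thesis by simp
  qed
  moreover have "M (fold S v (L y)) k = M (L (fold U v y)) k" if "v \<in> short_words r m" "k < r" for v k
  proof -
    have "same_pattern 0 r S M (L (fold U v y)) S M (fold S v (L y))"
      by (rule pat) (use that m in \<open>auto simp: short_words_def\<close>)
    with that(2) show ?thesis by (simp add: same_pattern_def short_words_def)
  qed
  ultimately show ?thesis by (simp add: same_pattern_def)
qed

section \<open>Soficity of treeings\<close>

type_synonym word_pattern = "(nat list \<times> nat list) set \<times> (nat list \<times> nat) set"

text \<open>The pattern stored as a value with finite range, so that it can serve as \<tau> in
  \<open>finite_model\<close>; the second set lists the digits that are \<open>True\<close>.\<close>

definition local_type :: "(nat \<Rightarrow> pt \<Rightarrow> pt) \<Rightarrow> nat \<Rightarrow> nat \<Rightarrow> pt \<Rightarrow> word_pattern" where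
  "local_type S n r x =
    ({(v, v') \<in> short_words r n \<times> short_words r n. fold S v x = fold S v' x}, {(v, k) \<in> short_words r n \<times> {..<r}. fold S v x k})"

lemma local_type_eq_iff:
  "local_type S n r x = local_type S n r x' \<longleftrightarrow> same_pattern n r S (\<lambda>z. z) x S (\<lambda>z. z) x'"
  unfolding local_type_def same_pattern_def set_eq_iff prod.inject by auto

lemma finite_range_local_type: "finite (range (local_type S n r))"
proof (rule finite_subset)
  show "range (local_type S n r) \<subseteq> Pow (short_words r n \<times> short_words r n) \<times> Pow (short_words r n \<times> {..<r})"
    by (auto simp: local_type_def)
qed (auto simp: finite_short_words)

lemma coordinate_measurable: "(\<lambda>x. x k) \<in> measurable mu (count_space UNIV)"
proof -
  have "(\<lambda>x. x k) \<in> measurable mu (measure_pmf (bernoulli_pmf (1/2)))"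
    unfolding mu_def by (rule measurable_component_singleton) simp
  then show ?thesis by (simp cong: measurable_cong_sets)
qed

lemma local_type_vimage:
  assumes S: "\<And>i. mpres (S i)"
  shows "local_type S n r -` {p} \<in> sets mu"
proof (cases "p \<in> range (local_type S n r)")
  case True
  then obtain x' where x': "p = local_type S n r x'" by auto
  note [measurable] = coordinate_measurable
  have [measurable]: "fold S v \<in> measurable mu mu" for v
  proof (induction v)
    case (Cons i v)
    then show ?case using S[of i] measurable_comp[of "S i" mu mu "fold S v" mu]
      by (simp add: mpres_def comp_def)
  qed (simp add: id_def)
  \<comment> \<open>Coincidence of two images is a countable conjunction of conditions on digits,
    hence measurable.\<close>
  have fe: "fold S v x = fold S v' x \<longleftrightarrow> (\<forall>k. fold S v x k = fold S v' x k)" for v v' x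
    by (simp add: fun_eq_iff)
  have "{x \<in> space mu. same_pattern n r S (\<lambda>z. z) x S (\<lambda>z. z) x'} \<in> sets mu"
    unfolding same_pattern_def fe by (measurable) (auto simp: finite_short_words intro: countable_finite)
  moreover have "local_type S n r -` {p} = {x \<in> space mu. same_pattern n r S (\<lambda>z. z) x S (\<lambda>z. z) x'}"
    by (auto simp: x' local_type_eq_iff)
  ultimately show ?thesis by simp
next
  case False
  then have "local_type S n r x \<noteq> p" for x by (metis rangeI)
  then have "local_type S n r -` {p} = {}" by auto
  then show ?thesis by simp
qed

section \<open>Covers that destroy short cycles\<close>

lemma fold_snd_cover:
  fixes U :: "nat \<Rightarrow> 'y \<times> 'g \<Rightarrow> 'y \<times> 'g"
  assumes "\<And>i z. U i z = z \<or> snd (U i z) = g i (snd z)"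
    and "\<And>j. j < length w \<Longrightarrow> U (w ! j) (fold U (take j w) z) \<noteq> fold U (take j w) z"
  shows "snd (fold U w z) = fold g w (snd z)"
  using assms(2)
proof (induction w arbitrary: z)
  case (Cons i w)
  have "U i z \<noteq> z" using Cons.prems[of 0] by simp
  then have a: "snd (U i z) = g i (snd z)" using assms(1) by metis
  have "U (w ! j) (fold U (take j w) (U i z)) \<noteq> fold U (take j w) (U i z)" if "j < length w" for j
    using Cons.prems[of "Suc j"] that by simp
  then have "snd (fold U w (U i z)) = fold g w (snd (U i z))"
    by (rule Cons.IH)
  then show ?case by (simp add: a)
qed simp

text \<open>Stationary steps of \<open>S\<close> are made stationary in \<open>U\<close>, so fixed
  points agree; every other step acts on both factors. A short non-backtracking walk then moves the
  second coordinate by \<open>girth\<close>, hence is not closed, and patterns propagate as on the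
  treeing.\<close>

lemma tree_cover:
  fixes S :: "nat \<Rightarrow> 'a \<Rightarrow> 'a" and M :: "'a \<Rightarrow> pt" and L :: "'y \<Rightarrow> 'a"
    and G :: "'g set"
  assumes S: "involutive_on UNIV r S"
    and \<sigma>: "involutive_on Y r \<sigma>" and g: "involutive_on G r g"
    and girth: "\<And>w p. w \<in> short_words r n \<Longrightarrow> w \<noteq> [] \<Longrightarrow> distinct_adj w \<Longrightarrow> p \<in> G \<Longrightarrow> fold g w p \<noteq> p"
    and step: "\<And>i y. i < r \<Longrightarrow> y \<in> Y \<Longrightarrow> same_pattern n r S M (L (\<sigma> i y)) S M (S i (L y))"
    and free: "\<And>y w. y \<in> Y \<Longrightarrow> w \<noteq> [] \<Longrightarrow> nb_walk S (L y) w \<Longrightarrow> fold S w (L y) \<noteq> L y"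
    and m: "2 * m \<le> n" "0 < m"
  defines "U \<equiv> \<lambda>i z. if S i (L (fst z)) = L (fst z) then z else (\<sigma> i (fst z), g i (snd z))"
  shows "involutive_on (Y \<times> G) r U"
    and "z \<in> Y \<times> G \<Longrightarrow> same_pattern m r S M (L (fst z)) U (\<lambda>z. M (L (fst z))) z"
proof -
  have "0 < n" using m by simp
  \<comment> \<open>The case distinction in \<open>U\<close> must give the same answer at both ends
    of a step, otherwise \<open>U i\<close> would not be an involution. A pattern of length at least
    1 ensures this, hence \<open>0 < m\<close>.\<close>
  have moved: "S i (L (\<sigma> i y)) \<noteq> L (\<sigma> i y)" if "i < r" "y \<in> Y" "S i (L y) \<noteq> L y" for i y
  proof -
    have "same_pattern (Suc (n - 1)) r S M (L (\<sigma> i y)) S M (S i (L y))"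
      using step[OF that(1,2)] \<open>0 < n\<close> by simp
    from same_pattern_fix[OF this that(1)] that show ?thesis
      using involutive_onD(2)[OF S that(1)] by (metis UNIV_I)
  qed
  show U: "involutive_on (Y \<times> G) r U"
    unfolding involutive_on_def
    using moved \<sigma> g by (auto simp: U_def involutive_onD)
  assume z: "z \<in> Y \<times> G"
  show "same_pattern m r S M (L (fst z)) U (\<lambda>z. M (L (fst z))) z"
  proof (rule same_pattern_of_local_equivariance[OF S U _ _ _ _ z m(1), where L = "\<lambda>z. L (fst z)"])
    show "same_pattern n r S M (L (fst (U i z))) S M (S i (L (fst z)))" if "i < r" "z \<in> Y \<times> G" for i z
      using step[OF that(1)] that(2) by (auto simp: U_def same_pattern_def)
    show "U i z = z \<longleftrightarrow> S i (L (fst z)) = L (fst z)" if "i < r" "z \<in> Y \<times> G" for i z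
    proof -
      \<comment> \<open>The one-letter word is covered by \<open>girth\<close>, so \<open>U\<close>
        fixes a point only in its first branch.\<close>
      have "g i (snd z) \<noteq> snd z"
        using girth[of "[i]" "snd z"] that \<open>0 < n\<close> by (auto simp: short_words_def)
      then show ?thesis by (cases z) (auto simp: U_def)
    qed
    show "fold S w (L (fst z)) \<noteq> L (fst z)" if "w \<noteq> []" "nb_walk S (L (fst z)) w" for w
      using free[OF _ that] z by auto
    show "fold U w z \<noteq> z" if "w \<noteq> []" "w \<in> short_words r n" "nb_walk U z w" for w
    proof -
      have "snd (fold U w z) = fold g w (snd z)"
        by (rule fold_snd_cover) (use that in \<open>auto simp: U_def nb_walk_def\<close>)
      also have "\<dots> \<noteq> snd z" using girth[OF that(2,1)] that(3) z by (auto simp: nb_walk_def)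
      finally show ?thesis by auto
    qed
  qed
qed

text \<open>Serves to move a model onto natural numbers, where \<open>fin_action\<close>
  lives.\<close>

lemma same_pattern_transport:
  assumes U: "involutive_on Z r U" and z: "z \<in> Z"
    and V: "\<And>i z. i < r \<Longrightarrow> z \<in> Z \<Longrightarrow> V i (b z) = b (U i z)"
    and b: "inj_on b Z" and L: "\<And>z. z \<in> Z \<Longrightarrow> L' (b z) = L z"
    and pat: "same_pattern n r S M x U L z"
  shows "same_pattern n r S M x V L' (b z)"
proof -
  have "fold V v (b z) = b (fold U v z)" if "set v \<subseteq> {..<r}" for v
    using that z
  proof (induction v arbitrary: z)
    case (Cons i v)
    then show ?case using V[of i z] involutive_onD(1)[OF U, of i z] by simp
  qed simp
  moreover have "fold U v z \<in> Z" if "set v \<subseteq> {..<r}" for v by (rule fold_in_carrier[OF U that z])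
  ultimately show ?thesis
    using pat b L by (auto simp: same_pattern_def short_words_def inj_on_eq_iff)
qed

lemma rg_iso_ball_iff:
  assumes "involutive_on A r T" "involutive_on B r U" "x \<in> A" "y \<in> B"
    and pat: "same_pattern (Suc r) r T L x U M y" and "s \<le> r"
  shows "rg_iso (ball s A T L x) H \<longleftrightarrow> rg_iso (ball s B U M y) H"
  using rg_iso_trans[OF ball_iso[OF assms]]
    rg_iso_trans[OF ball_iso[OF assms(2,1,4,3) same_pattern_sym[OF pat] assms(6)]] by blast

lemma finite_approximation:
  assumes S: "mp_involutions S" and tree: "treeing S" and e: "e > 0"
  obtains Y \<sigma> L where "fin_action Y \<sigma>"
    "\<And>s \<alpha>. s \<le> r \<Longrightarrow> \<bar>p_fin Y \<sigma> L s \<alpha> - p_X S s \<alpha>\<bar> \<le> e"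
proof -
  interpret prob_space mu by (rule prob_space_mu)
  \<comment> \<open>Edges of a ball of radius \<open>r\<close> need words of length
    \<open>Suc r\<close>, and comparing two of these needs closed words of twice that
    length.\<close>
  define m where "m = Suc r"
  define n where "n = 2 * m"
  define \<tau> where "\<tau> = local_type S n r"
  have Sinv: "involutive_on UNIV r S" using S by (auto simp: involutive_on_def mp_involutions_def)
  have fin\<tau>: "finite (range \<tau>)" unfolding \<tau>_def by (rule finite_range_local_type)
  have m\<tau>: "\<tau> -` {p} \<in> sets mu" for p
    unfolding \<tau>_def using S by (intro local_type_vimage) (auto simp: mp_involutions_def)
  from tree obtain N where N: "N \<in> null_sets mu"
    and "\<And>x. x \<notin> N \<Longrightarrow> \<forall>y. (x, y) \<in> orbit_rel S \<longrightarrow> \<not> (\<exists>ws. closed_walk S y ws)"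
    unfolding treeing_def eventually_ae_filter by auto
  moreover have "(x, x) \<in> orbit_rel S" for x
    by (auto simp: orbit_rel_def act_word_def intro!: exI[of _ "[]"])
  ultimately have free: "fold S w x \<noteq> x" if "x \<notin> N" "w \<noteq> []" "nb_walk S x w" for x w
    using that unfolding closed_walk_iff by blast
  define e' where "e' = e / real (card (range \<tau>))"
  have "card (range \<tau>) > 0" using fin\<tau> by (simp add: card_gt_0_iff)
  with e have "e' > 0" by (simp add: e'_def)
  obtain Y0 :: "((word_pattern \<times> word_pattern list) \<times> nat) set" and \<sigma>0 L0 where Y0: "finite Y0" "Y0 \<noteq> {}"
    "\<And>y. y \<in> Y0 \<Longrightarrow> L0 y \<notin> N"
    "\<And>i y. i < r \<Longrightarrow> y \<in> Y0 \<Longrightarrow> \<sigma>0 i y \<in> Y0 \<and> \<sigma>0 i (\<sigma>0 i y) = y \<and> \<tau> (L0 (\<sigma>0 i y)) = \<tau> (S i (L0 y))"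
    "\<And>p. \<bar>real (card {y \<in> Y0. \<tau> (L0 y) = p}) / real (card Y0) - measure mu (\<tau> -` {p})\<bar> \<le> e'"
    by (rule finite_model[OF S fin\<tau> m\<tau> N \<open>e' > 0\<close>, of r]) (rule that)
  obtain G :: "(nat list \<Rightarrow> nat list) set" and g where G: "finite G" "G \<noteq> {}" "involutive_on G r g"
    "\<And>w p. w \<in> short_words r n \<Longrightarrow> w \<noteq> [] \<Longrightarrow> distinct_adj w \<Longrightarrow> p \<in> G \<Longrightarrow> fold g w p \<noteq> p"
    by (rule large_girth_involutions[of r n]) (rule that)
  define Z where "Z = Y0 \<times> G"
  define U where "U = (\<lambda>i z. if S i (L0 (fst z)) = L0 (fst z) then z else (\<sigma>0 i (fst z), g i (snd z)))"
  have \<sigma>0: "involutive_on Y0 r \<sigma>0" using Y0(4) by (auto simp: involutive_on_def)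
  have step: "same_pattern n r S (\<lambda>z. z) (L0 (\<sigma>0 i y)) S (\<lambda>z. z) (S i (L0 y))"
    if "i < r" "y \<in> Y0" for i y
    using Y0(4)[OF that] by (simp add: \<tau>_def local_type_eq_iff)
  have m: "2 * m \<le> n" "0 < m" by (auto simp: m_def n_def)
  note cover = tree_cover[OF Sinv \<sigma>0 G(3,4) step free[OF Y0(3)] m, folded U_def Z_def]
  have U: "involutive_on Z r U" by (rule cover(1))
  have pat: "same_pattern m r S (\<lambda>z. z) (L0 (fst z)) U (\<lambda>z. L0 (fst z)) z" if "z \<in> Z" for z
    by (rule cover(2)) (use that in auto)
  have finZ: "finite Z" and "Z \<noteq> {}" using Y0 G by (auto simp: Z_def)
  obtain b where b: "bij_betw b Z {0..<card Z}" using ex_bij_betw_finite_nat[OF finZ] by blast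
  then have b_inj: "inj_on b Z" and b_im: "b ` Z = {0..<card Z}" by (auto simp: bij_betw_def)
  define Y where "Y = {0..<card Z}"
  define c where "c = inv_into Z b"
  \<comment> \<open>Generators from \<open>r\<close> on act trivially: balls of radius at most
    \<open>r\<close> do not see them.\<close>
  define V where "V i k = (if i < r \<and> k \<in> Y then b (U i (c k)) else k)" for i k
  define L where "L k = L0 (fst (c k))" for k
  have cb: "c (b z) = z" if "z \<in> Z" for z using b_inj that by (simp add: c_def)
  have bY: "b z \<in> Y" if "z \<in> Z" for z using b_im that by (auto simp: Y_def)
  have Vb: "V i (b z) = b (U i z)" if "i < r" "z \<in> Z" for i z using that by (simp add: V_def cb bY)
  have V: "involutive_on Y r V"
    unfolding involutive_on_def
  proof (intro allI impI ballI)
    fix i k assume i: "i < r" and "k \<in> Y"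
    then obtain z where z: "z \<in> Z" "k = b z" unfolding Y_def b_im[symmetric] by blast
    then show "V i k \<in> Y \<and> V i (V i k) = k"
      using involutive_onD[OF U i z(1)] by (simp add: Vb[OF i] bY)
  qed
  have fin_act: "fin_action Y V"
    unfolding fin_action_def
  proof (intro conjI allI)
    show "finite Y" "Y \<noteq> {}" using finZ \<open>Z \<noteq> {}\<close> by (auto simp: Y_def card_gt_0_iff)
    fix i
    show "bij_betw (V i) Y Y"
    proof (cases "i < r")
      case True
      then show ?thesis using V
        by (intro bij_betwI[where g = "V i"]) (auto simp: involutive_onD)
    qed (simp add: V_def bij_betw_def inj_on_def)
  qed
  have "\<bar>p_fin Y V L s \<alpha> - p_X S s \<alpha>\<bar> \<le> e" if s: "s \<le> r" for s \<alpha>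
  proof -
    define P where "P x = rg_iso (ball s UNIV S (\<lambda>y. y) x) \<alpha>" for x
    \<comment> \<open>Having a given ball type depends only on the value of \<tau>, so both
      proportions become sums over the same finite set of patterns.\<close>
    define A where "A = \<tau> ` {x. P x}"
    have PA: "P x \<longleftrightarrow> \<tau> x \<in> A" for x
    proof
      assume "\<tau> x \<in> A"
      then obtain x' where x': "P x'" "\<tau> x = \<tau> x'" by (auto simp: A_def)
      then have "same_pattern m r S (\<lambda>z. z) x S (\<lambda>z. z) x'"
        unfolding \<tau>_def local_type_eq_iff by (rule_tac same_pattern_mono) (auto simp: n_def)
      from rg_iso_ball_iff[where H = \<alpha>, OF Sinv Sinv UNIV_I UNIV_I this[unfolded m_def] s] x' show "P x"
        by (simp add: P_def)
    qed (auto simp: A_def)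
    have finA: "finite A" using fin\<tau> by (rule finite_subset[rotated]) (auto simp: A_def)
    have "P (L0 (fst z)) \<longleftrightarrow> rg_iso (ball s Y V L (b z)) \<alpha>" if "z \<in> Z" for z
    proof -
      have "same_pattern m r S (\<lambda>z. z) (L0 (fst z)) V L (b z)"
        by (rule same_pattern_transport[OF U that Vb b_inj _ pat[OF that]]) (simp_all add: L_def cb)
      from rg_iso_ball_iff[where H = \<alpha>, OF Sinv V UNIV_I bY[OF that] this[unfolded m_def] s] show ?thesis
        by (simp add: P_def)
    qed
    then have "{k \<in> Y. rg_iso (ball s Y V L k) \<alpha>} = b ` {z \<in> Z. P (L0 (fst z))}"
      unfolding Y_def b_im[symmetric] by blast
    also have "card \<dots> = card {z \<in> Z. P (L0 (fst z))}"
      by (rule card_image) (use b_inj in \<open>auto simp: inj_on_def\<close>)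
    \<comment> \<open>All copies of a point over \<open>G\<close> have the same ball type, so
      passing to the product leaves proportions unchanged.\<close>
    also have "{z \<in> Z. P (L0 (fst z))} = {y \<in> Y0. P (L0 y)} \<times> G" by (auto simp: Z_def)
    finally have "p_fin Y V L s \<alpha> = real (card {y \<in> Y0. P (L0 y)}) / real (card Y0)"
      using G(1,2) by (simp add: p_fin_def card_cartesian_product Y_def Z_def)
    also have "{y \<in> Y0. P (L0 y)} = (\<Union>p\<in>A. {y \<in> Y0. \<tau> (L0 y) = p})" by (auto simp: PA)
    also have "card \<dots> = (\<Sum>p\<in>A. card {y \<in> Y0. \<tau> (L0 y) = p})"
      by (rule card_UN_disjoint) (use finA Y0(1) in auto)
    finally have pf: "p_fin Y V L s \<alpha> = (\<Sum>p\<in>A. real (card {y \<in> Y0. \<tau> (L0 y) = p}) / real (card Y0))"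
      by (simp add: sum_divide_distrib)
    have "p_X S s \<alpha> = measure mu {x. P x}" by (simp add: p_X_def P_def)
    also have "{x. P x} = (\<Union>p\<in>A. \<tau> -` {p})" by (auto simp: PA)
    also have "measure mu \<dots> = (\<Sum>p\<in>A. measure mu (\<tau> -` {p}))"
      by (rule finite_measure_finite_Union) (use finA m\<tau> in \<open>auto simp: disjoint_family_on_def\<close>)
    finally have "\<bar>p_fin Y V L s \<alpha> - p_X S s \<alpha>\<bar> =
      \<bar>\<Sum>p\<in>A. real (card {y \<in> Y0. \<tau> (L0 y) = p}) / real (card Y0) - measure mu (\<tau> -` {p})\<bar>"
      by (simp add: pf sum_subtractf)
    also have "\<dots> \<le> (\<Sum>p\<in>A. e')" by (rule order_trans[OF sum_abs sum_mono[OF Y0(5)]])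
    also have "\<dots> \<le> (\<Sum>p\<in>range \<tau>. e')"
      by (rule sum_mono2) (use fin\<tau> \<open>e' > 0\<close> in \<open>auto simp: A_def\<close>)
    also have "\<dots> = e" using \<open>card (range \<tau>) > 0\<close> by (simp add: e'_def)
    finally show ?thesis .
  qed
  with fin_act show ?thesis by (rule that)
qed

text \<open>The n-th model is accurate to 1/(n+1) for all radii up to n, so one sequence serves
  every radius.\<close>

lemma sofic_action_of_treeing:
  assumes "mp_involutions S" "treeing S"
  shows "sofic_action S"
proof -
  have "\<exists>Y \<sigma> L. fin_action Y \<sigma> \<and> (\<forall>s\<le>n. \<forall>\<alpha>. \<bar>p_fin Y \<sigma> L s \<alpha> - p_X S s \<alpha>\<bar> \<le> 1 / real (Suc n))" for n
  proof -
    have "1 / real (Suc n) > 0" by simp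
    from finite_approximation[OF assms this, of n] show ?thesis by metis
  qed
  then obtain Y \<sigma> L where YL: "\<And>n. fin_action (Y n) (\<sigma> n)"
    "\<And>n s \<alpha>. s \<le> n \<Longrightarrow> \<bar>p_fin (Y n) (\<sigma> n) (L n) s \<alpha> - p_X S s \<alpha>\<bar> \<le> 1 / real (Suc n)" by metis
  have "(\<lambda>n. p_fin (Y n) (\<sigma> n) (L n) s \<alpha>) \<longlonglongrightarrow> p_X S s \<alpha>" for s \<alpha>
  proof (rule Lim_transform_bound[where g = "\<lambda>n. 1 / real (Suc n)", THEN LIM_zero_cancel])
    show "\<forall>\<^sub>F n in sequentially. norm (p_fin (Y n) (\<sigma> n) (L n) s \<alpha> - p_X S s \<alpha>) \<le> norm (1 / real (Suc n))"
      using eventually_ge_at_top[of s] by eventually_elim (use YL(2) in auto)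
    show "(\<lambda>n. 1 / real (Suc n)) \<longlonglongrightarrow> 0" using LIMSEQ_inverse_real_of_nat by (simp add: field_simps)
  qed
  with YL(1) show ?thesis unfolding sofic_action_def by blast
qed

section \<open>Free actions of free groups\<close>

lemma mpresI:
  assumes "f \<in> measurable mu mu" "\<And>B. B \<in> sets mu \<Longrightarrow> measure mu (f -` B) = measure mu B"
  shows "mpres f"
proof -
  interpret prob_space mu by (rule prob_space_mu)
  have "distr mu mu f = mu"
    using assms by (intro measure_eqI) (auto simp: emeasure_distr emeasure_eq_measure)
  with assms(1) show ?thesis by (simp add: mpres_def)
qed

lemma mpres_id: "mpres (\<lambda>x. x)"
  by (rule mpresI) auto

lemma mpres_comp:
  assumes "mpres f" "mpres g" shows "mpres (\<lambda>x. f (g x))"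
  using assms by (intro mpresI)
    (auto simp: mpres_def vimage_sets_mu measure_vimage_mpres vimage_comp[unfolded comp_def, symmetric])

lemma AE_mpres:
  assumes "mpres f" "AE x in mu. P x" shows "AE x in mu. P (f x)"
proof (rule AE_distrD[of f mu mu])
  from assms(1) show f: "f \<in> measurable mu mu" by (simp add: mpres_def)
  from assms(1) have "distr mu mu f = mu" by (simp add: mpres_def)
  with assms(2) show "AE x in distr mu mu f. P x" by (simp only:)
qed

text \<open>For a bijection \<open>f\<close>, the test \<open>inv f x \<in> A\<close> says that
  \<open>x\<close> lies in the image of \<open>A\<close>, phrased as a preimage so that
  measurability is at hand.\<close>

definition swap_piece :: "('a \<Rightarrow> 'a) \<Rightarrow> 'a set \<Rightarrow> 'a \<Rightarrow> 'a" where
  "swap_piece f A x = (if x \<in> A then f x else if inv f x \<in> A then inv f x else x)"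

lemma swap_piece_involutive:
  assumes "bij f" "f ` A \<inter> A = {}"
  shows "swap_piece f A (swap_piece f A x) = x"
proof -
  have "inv f (f y) = y" "f (inv f y) = y" for y
    using assms(1) by (simp_all add: bij_is_inj bij_is_surj surj_f_inv_f)
  with assms(2) show ?thesis by (auto simp: swap_piece_def)
qed

text \<open>A preimage splits into its parts in \<open>A\<close>, in the image of \<open>A\<close>
  and outside both. \<open>f\<close> and its inverse carry the first two onto the parts of
  \<open>B\<close> in the image and in \<open>A\<close>; the third is left alone.\<close>

lemma swap_piece_mpres:
  assumes f: "bij f" "mpres f" "mpres (inv f)" and A: "A \<in> sets mu" and disj: "f ` A \<inter> A = {}"
  shows "mpres (swap_piece f A)"
proof (rule mpresI)
  interpret prob_space mu by (rule prob_space_mu)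
  have inv: "inv f (f y) = y" "f (inv f y) = y" for y
    using f(1) by (simp_all add: bij_is_inj bij_is_surj surj_f_inv_f)
  have pre: "(\<lambda>x. x \<in> A) \<in> measurable mu (count_space UNIV)"
    "(\<lambda>x. inv f x \<in> A) \<in> measurable mu (count_space UNIV)"
    using A vimage_sets_mu[OF f(3) A] by (auto simp: pred_def vimage_def)
  have [measurable]: "f \<in> measurable mu mu" "inv f \<in> measurable mu mu"
    using f by (auto simp: mpres_def)
  show "swap_piece f A \<in> measurable mu mu"
    unfolding swap_piece_def[abs_def] using pre by measurable
  fix B assume B: "B \<in> sets mu"
  define fA where "fA = inv f -` A"
  have fA: "fA \<in> sets mu" unfolding fA_def by (rule vimage_sets_mu[OF f(3) A])
  have dj: "A \<inter> fA = {}" using disj inv by (force simp: fA_def)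
  have fB: "f -` B \<in> sets mu" and AB: "inv f -` (A \<inter> B) \<in> sets mu"
    using vimage_sets_mu[OF f(2) B] vimage_sets_mu[OF f(3)] A B by auto
  have "swap_piece f A -` B = (A \<inter> f -` B \<union> inv f -` (A \<inter> B)) \<union> (B - (A \<union> fA))"
    using dj unfolding fA_def disjoint_iff by (auto simp: swap_piece_def split: if_splits)
  also have "measure mu \<dots> = measure mu (A \<inter> f -` B) + measure mu (inv f -` (A \<inter> B))
      + measure mu (B - (A \<union> fA))"
    using A B fA fB AB dj by (subst finite_measure_Union finite_measure_Union; auto simp: fA_def)+
  also have "measure mu (inv f -` (A \<inter> B)) = measure mu (A \<inter> B)"
    using A B by (intro measure_vimage_mpres[OF f(3)]) auto
  also have "measure mu (A \<inter> f -` B) = measure mu (inv f -` (A \<inter> f -` B))"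
    using A fB by (intro measure_vimage_mpres[OF f(3), symmetric]) auto
  also have "inv f -` (A \<inter> f -` B) = fA \<inter> B" by (auto simp: fA_def inv)
  also have "measure mu (fA \<inter> B) + measure mu (A \<inter> B) + measure mu (B - (A \<union> fA))
      = measure mu ((fA \<inter> B \<union> A \<inter> B) \<union> (B - (A \<union> fA)))"
    using A B fA dj by (subst finite_measure_Union finite_measure_Union; auto)+
  also have "(fA \<inter> B \<union> A \<inter> B) \<union> (B - (A \<union> fA)) = B" by auto
  finally show "measure mu (swap_piece f A -` B) = measure mu B" .
qed

text \<open>The piece of index \<open>2 * n + b\<close> consists of the points whose first digit moved by
  \<open>f\<close> is the \<open>n\<close>-th one, with value \<open>b\<close>; a piece is thus disjoint from its image.\<close>
definition digit_piece :: "(pt \<Rightarrow> pt) \<Rightarrow> nat \<Rightarrow> pt set" where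
  "digit_piece f m = {x. x (m div 2) = odd m \<and> f x (m div 2) \<noteq> odd m \<and> (\<forall>j<m div 2. f x j = x j)}"

lemma digit_piece_image_disjoint: "f ` digit_piece f m \<inter> digit_piece f m = {}"
  by (auto simp: digit_piece_def)

lemma digit_piece_unique:
  assumes "x \<in> digit_piece f m" "x \<in> digit_piece f m'"
  shows "m = m'"
proof -
  have "m div 2 = m' div 2"
    using assms by (cases "m div 2" "m' div 2" rule: linorder_cases) (auto simp: digit_piece_def)
  moreover have "odd m = odd m'" using assms calculation by (auto simp: digit_piece_def)
  ultimately show ?thesis by presburger
qed

lemma digit_piece_exists:
  assumes "f x \<noteq> x" obtains m where "x \<in> digit_piece f m"
proof -
  define n where "n = (LEAST n. f x n \<noteq> x n)"
  from assms obtain n0 where "f x n0 \<noteq> x n0" by (auto simp: fun_eq_iff)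
  then have n: "f x n \<noteq> x n" unfolding n_def by (rule LeastI)
  have "f x j = x j" if "j < n" for j using that not_less_Least unfolding n_def by blast
  with n have "x \<in> digit_piece f (2 * n + of_bool (x n))"
    by (cases "x n") (auto simp: digit_piece_def)
  then show ?thesis by (rule that)
qed

lemma digit_piece_sets:
  assumes "f \<in> measurable mu mu" shows "digit_piece f m \<in> sets mu"
proof -
  note [measurable] = assms coordinate_measurable
  have "{x \<in> space mu. x (m div 2) = odd m \<and> f x (m div 2) \<noteq> odd m \<and> (\<forall>j<m div 2. f x j = x j)}
      \<in> sets mu" by measurable
  then show ?thesis by (simp add: digit_piece_def)
qed

section \<open>Orbit relations of involutions and of free actions\<close>

lemma orbit_rel_involutions:
  assumes "\<And>i x. S i (S i x) = x"
  shows "orbit_rel S = {(x, fold S v x) | x v. True}"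
proof -
  have S: "involutive_on UNIV r S" for r using assms by (simp add: involutive_on_def)
  have "act_word UNIV S w x = fold S (rev (map fst w)) x" for w x
  proof -
    \<comment> \<open>One word involves finitely many generators, so a bound depending on the word
      suffices.\<close>
    obtain r where "\<forall>l\<in>set w. fst l < r"
      using finite_nat_set_iff_bounded[of "fst ` set w"] by auto
    then show ?thesis by (rule act_word_involutive[OF S _ UNIV_I])
  qed
  moreover have "fold S v x = fold S (rev (map fst (map (\<lambda>i. (i, True)) (rev v)))) x" for v x
    by (simp add: rev_map comp_def)
  ultimately show ?thesis unfolding orbit_rel_def by (metis (lifting))
qed

lemma mp_action_of_involutions:
  assumes "mp_involutions S" shows "mp_action S"
proof -
  have "S i (S i x) = x" for i x using assms by (simp add: mp_involutions_def)
  then have "bij (S i)" "inv (S i) = S i" for i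
    by (auto intro!: o_bij[of "S i" "S i"] inv_unique_comp)
  then show ?thesis using assms by (simp add: mp_action_def mp_involutions_def)
qed

lemma reduced_Cons:
  "reduced (l # w) \<longleftrightarrow> (w \<noteq> [] \<longrightarrow> \<not> (fst l = fst (hd w) \<and> snd l \<noteq> snd (hd w))) \<and> reduced w"
  by (cases w) auto

text \<open>An index \<open>k\<close> codes a generator and one of its pieces, and
  \<open>S k\<close> swaps that piece with its image. Every point moved by a generator lies in
  exactly one of its pieces, so non-backtracking walks spell reduced words, which freeness keeps
  from closing.\<close>

lemma treeable_of_free_action:
  fixes I :: "nat set" and T :: "nat \<Rightarrow> pt \<Rightarrow> pt"
  assumes T: "\<And>i. i \<in> I \<Longrightarrow> bij (T i) \<and> mpres (T i) \<and> mpres (inv (T i))"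
    and free: "AE x in mu. \<forall>w. w \<noteq> [] \<and> reduced w \<and> (\<forall>l\<in>set w. fst l \<in> I) \<longrightarrow> act_word UNIV T w x \<noteq> x"
  shows "treeable {(x, act_word UNIV T w x) | x w. \<forall>l\<in>set w. fst l \<in> I}" (is "treeable ?E")
proof -
  define A where "A k = digit_piece (T (fst (prod_decode k))) (snd (prod_decode k))" for k
  define S where "S k = (if fst (prod_decode k) \<in> I
    then swap_piece (T (fst (prod_decode k))) (A k) else (\<lambda>x. x))" for k
  have inv: "inv (T i) (T i y) = y" "T i (inv (T i) y) = y" if "i \<in> I" for i y
    using T[OF that] by (simp_all add: bij_is_inj bij_is_surj surj_f_inv_f)
  have SS: "S k (S k x) = x" for k x
    using T by (simp add: S_def A_def swap_piece_involutive digit_piece_image_disjoint)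
  have "mpres (S k)" for k
  proof (cases "fst (prod_decode k) \<in> I")
    case True
    have "A k \<in> sets mu" unfolding A_def using T[OF True] by (intro digit_piece_sets) (simp add: mpres_def)
    with True T[OF True] show ?thesis
      by (simp add: S_def A_def swap_piece_mpres digit_piece_image_disjoint)
  qed (simp add: S_def mpres_id)
  with SS have mpS: "mp_involutions S" by (simp add: mp_involutions_def)
  \<comment> \<open>The letter by which \<open>S k\<close> moves \<open>x\<close>: forward from the
    piece, backward from its image.\<close>
  define lt where "lt k x = (fst (prod_decode k), x \<in> A k)" for k x
  have lt: "fst (lt k x) \<in> I \<and> S k x = act_letter UNIV T (lt k x) x" if "S k x \<noteq> x" for k x
    using that by (auto simp: S_def lt_def act_letter_def swap_piece_def split: if_splits)
  have letter: "act_letter UNIV T l x = x \<or> (\<exists>k. act_letter UNIV T l x = S k x)"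
    if l: "fst l \<in> I" for l x
  proof -
    obtain i b where ib: "l = (i, b)" by force
    have moved: "\<exists>k. T i y = S k y \<and> y = S k (T i y)" if "T i y \<noteq> y" for y
    proof -
      obtain m where "y \<in> digit_piece (T i) m" using digit_piece_exists[of "T i" y, OF \<open>T i y \<noteq> y\<close>] .
      then have "T i y = S (prod_encode (i, m)) y" using l ib by (simp add: S_def A_def swap_piece_def)
      with SS show ?thesis by metis
    qed
    show ?thesis
    proof (cases b)
      case True
      with moved[of x] show ?thesis by (auto simp: ib act_letter_def)
    next
      case False
      \<comment> \<open>Seen from its target, an inverse letter is a forward step, undone by the
        same involution.\<close>
      have "inv (T i) x = x \<or> (\<exists>k. inv (T i) x = S k x)"
        using moved[of "inv (T i) x"] inv(2)[of i x] l ib by fastforce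
      with False show ?thesis by (simp add: ib act_letter_def)
    qed
  qed
  have orbS: "orbit_rel S = {(x, fold S v x) | x v. True}" by (rule orbit_rel_involutions[OF SS])
  have words: "\<exists>v. act_word UNIV T w x = fold S v x" if "\<forall>l\<in>set w. fst l \<in> I" for w x
    using that
  proof (induction w)
    case Nil
    show ?case by (auto simp: act_word_def intro: exI[of _ "[]"])
  next
    case (Cons l w)
    then obtain v where v: "act_word UNIV T w x = fold S v x" by auto
    have "act_word UNIV T (l # w) x = act_letter UNIV T l (fold S v x)"
      using v by (simp add: act_word_def)
    moreover have "S k (fold S v x) = fold S (v @ [k]) x" for k by simp
    ultimately show ?case using letter[of l "fold S v x"] Cons.prems by (metis list.set_intros(1))
  qed
  have orb: "\<exists>w. fold S v x = act_word UNIV T w x \<and> (\<forall>l\<in>set w. fst l \<in> I)" for v x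
  proof (induction v rule: rev_induct)
    case Nil
    show ?case by (auto simp: act_word_def intro: exI[of _ "[]"])
  next
    case (snoc k v)
    then obtain w where w: "fold S v x = act_word UNIV T w x" "\<forall>l\<in>set w. fst l \<in> I" by auto
    show ?case
    proof (cases "S k (fold S v x) = fold S v x")
      case False
      from lt[OF this] w show ?thesis
        by (intro exI[of _ "lt k (fold S v x) # w"]) (simp add: act_word_def)
    qed (use w in auto)
  qed
  have E: "?E = orbit_rel S"
  proof (intro equalityI subsetI)
    fix p assume "p \<in> ?E"
    then obtain x w where "p = (x, act_word UNIV T w x)" "\<forall>l\<in>set w. fst l \<in> I" by auto
    with words[of w x] show "p \<in> orbit_rel S" by (auto simp: orbS)
  next
    fix p assume "p \<in> orbit_rel S"
    then obtain x v where "p = (x, fold S v x)" by (auto simp: orbS)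
    with orb[of v x] show "p \<in> ?E" by auto
  qed
  have mpw: "mpres (act_word UNIV T w)" if "\<forall>l\<in>set w. fst l \<in> I" for w
    using that
  proof (induction w)
    case (Cons l w)
    have "mpres (act_letter UNIV T l)" using T Cons.prems by (cases "snd l") (simp_all add: act_letter_def[abs_def])
    with Cons mpres_comp[of "act_letter UNIV T l" "act_word UNIV T w"] show ?case
      by (simp add: act_word_def[abs_def])
  qed (simp add: act_word_def[abs_def] id_def mpres_id)
  \<comment> \<open>A treeing excludes cycles at all points of the orbit, so freeness is pulled back
    along each of the countably many words.\<close>
  have "AE x in mu. (\<forall>l\<in>set u. fst l \<in> I) \<longrightarrow> (\<forall>w. w \<noteq> [] \<and> reduced w \<and> (\<forall>l\<in>set w. fst l \<in> I) \<longrightarrow>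
      act_word UNIV T w (act_word UNIV T u x) \<noteq> act_word UNIV T u x)" for u
  proof (cases "\<forall>l\<in>set u. fst l \<in> I")
    case True
    from AE_mpres[OF mpw[OF True] free] show ?thesis by eventually_elim (rule impI)
  next
    case False
    show ?thesis by (rule AE_I2) (use False in blast)
  qed
  then have free_orbit: "AE x in mu. \<forall>u. (\<forall>l\<in>set u. fst l \<in> I) \<longrightarrow>
      (\<forall>w. w \<noteq> [] \<and> reduced w \<and> (\<forall>l\<in>set w. fst l \<in> I) \<longrightarrow>
      act_word UNIV T w (act_word UNIV T u x) \<noteq> act_word UNIV T u x)"
    by (simp add: AE_all_countable)
  \<comment> \<open>The claim on \<open>hd w\<close>, the letter applied last, is what the induction
    needs to check that the next letter does not cancel it.\<close>
  have walk: "\<exists>w. act_word UNIV T w y = fold S ws y \<and> reduced w \<and> (\<forall>l\<in>set w. fst l \<in> I) \<and> (w = [] \<longleftrightarrow> ws = [])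
      \<and> (ws \<noteq> [] \<longrightarrow> hd w = lt (last ws) (fold S (butlast ws) y))" if "nb_walk S y ws" for y ws
    using that
  proof (induction ws rule: rev_induct)
    case Nil
    show ?case by (auto simp: act_word_def intro: exI[of _ "[]"])
  next
    case (snoc k ws)
    define z where "z = fold S ws y"
    have nb: "nb_walk S y ws" and kz: "S k z \<noteq> z"
      and adj: "ws \<noteq> [] \<Longrightarrow> last ws \<noteq> k"
      and last_step: "ws \<noteq> [] \<Longrightarrow> S (last ws) (fold S (butlast ws) y) \<noteq> fold S (butlast ws) y"
    proof -
      have st: "S ((ws @ [k]) ! j) (fold S (take j (ws @ [k])) y) \<noteq> fold S (take j (ws @ [k])) y"
        if "j < Suc (length ws)" for j
        using snoc.prems that by (simp add: nb_walk_def)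
      have da: "distinct_adj (ws @ [k])" using snoc.prems by (simp add: nb_walk_def)
      then show "ws \<noteq> [] \<Longrightarrow> last ws \<noteq> k" by (simp add: distinct_adj_append_iff)
      have st': "S (ws ! j) (fold S (take j ws) y) \<noteq> fold S (take j ws) y" if "j < length ws" for j
        using st[of j] that by (simp add: nth_append)
      then show "nb_walk S y ws" using da by (simp add: nb_walk_def distinct_adj_append_iff)
      show "S k z \<noteq> z" using st[of "length ws"] by (simp add: z_def)
      show "S (last ws) (fold S (butlast ws) y) \<noteq> fold S (butlast ws) y" if "ws \<noteq> []"
        using st'[of "length ws - 1"] that by (simp add: last_conv_nth butlast_conv_take)
    qed
    from snoc.IH[OF nb] obtain w where w: "act_word UNIV T w y = z" "reduced w" "\<forall>l\<in>set w. fst l \<in> I"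
      "w = [] \<longleftrightarrow> ws = []" "ws \<noteq> [] \<longrightarrow> hd w = lt (last ws) (fold S (butlast ws) y)"
      by (auto simp: z_def)
    have "\<not> (fst (lt k z) = fst (hd w) \<and> snd (lt k z) \<noteq> snd (hd w))" if "w \<noteq> []"
    proof
      assume eq: "fst (lt k z) = fst (hd w) \<and> snd (lt k z) \<noteq> snd (hd w)"
      define k' where "k' = last ws"
      define z' where "z' = fold S (butlast ws) y"
      have ne: "ws \<noteq> []" and hd: "hd w = lt k' z'" using that w by (auto simp: k'_def z'_def)
      have zz': "z = S k' z'"
        using ne by (cases ws rule: rev_cases) (simp_all add: z_def k'_def z'_def)
      have k': "S k' z' \<noteq> z'" using last_step[OF ne] by (simp add: k'_def z'_def)
      have "snd (prod_decode k) = snd (prod_decode k')"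
      proof -
        define i where "i = fst (prod_decode k)"
        have i: "fst (prod_decode k) = i" "fst (prod_decode k') = i" and ne_piece: "(z \<in> A k) \<noteq> (z' \<in> A k')"
          using eq by (auto simp: i_def hd lt_def)
        have "i \<in> I" using lt[OF kz] by (simp add: lt_def i)
        \<comment> \<open>Opposite signs mean that the second step retraces the first: if the first
          goes forward, \<open>z'\<close> lies in both pieces, otherwise \<open>z\<close> does.
          Uniqueness of pieces then forces equal indices.\<close>
        have "\<exists>x. x \<in> A k \<and> x \<in> A k'"
          using ne_piece kz k' inv[OF \<open>i \<in> I\<close>] \<open>i \<in> I\<close> unfolding zz'
          by (auto simp: S_def i swap_piece_def split: if_splits)
        then show ?thesis unfolding A_def i using digit_piece_unique by blast
      qed
      moreover have "fst (prod_decode k) = fst (prod_decode k')" using eq by (simp add: hd lt_def)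
      ultimately have "prod_decode k = prod_decode k'" by (simp add: prod_eq_iff)
      with adj[OF ne] show False using inj_prod_decode by (auto simp: k'_def inj_on_def)
    qed
    with w lt[OF kz] show ?case
      by (intro exI[of _ "lt k z # w"]) (auto simp: reduced_Cons act_word_def z_def)
  qed
  have "treeing S"
    unfolding treeing_def using free_orbit
  proof eventually_elim
    case (elim x)
    show ?case
    proof (intro allI impI notI, elim exE)
      fix y ws assume "(x, y) \<in> orbit_rel S" "closed_walk S y ws"
      then obtain u w where "y = act_word UNIV T u x" "\<forall>l\<in>set u. fst l \<in> I"
        "act_word UNIV T w y = y" "reduced w" "\<forall>l\<in>set w. fst l \<in> I" "w \<noteq> []"
        unfolding orbS closed_walk_iff using orb walk by fastforce
      with elim show False by blast
    qed
  qed
  with mpS E show ?thesis unfolding treeable_def by blast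
qed

theorem theorem7p4:
  fixes S :: "nat \<Rightarrow> pt \<Rightarrow> pt"
  assumes "mp_involutions S"
    and "treeing S"
  shows "sofic_action S
    \<and> (\<forall>E. treeable E \<longrightarrow> sofic_rel E)
    \<and> (\<forall>(I :: nat set) (T :: nat \<Rightarrow> pt \<Rightarrow> pt).
          (\<forall>i\<in>I. bij (T i) \<and> mpres (T i) \<and> mpres (inv (T i)))
          \<and> (AE x in mu. \<forall>w. w \<noteq> [] \<and> reduced w \<and> (\<forall>l\<in>set w. fst l \<in> I)
                               \<longrightarrow> act_word UNIV T w x \<noteq> x)
          \<longrightarrow> sofic_rel {(x, act_word UNIV T w x) | x w. \<forall>l\<in>set w. fst l \<in> I})"
proof (intro conjI allI impI)
  show "sofic_action S" using assms by (rule sofic_action_of_treeing)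
  have rel: "sofic_rel E" if "treeable E" for E
    using that mp_action_of_involutions sofic_action_of_treeing
    unfolding treeable_def sofic_rel_def by blast
  show "sofic_rel E" if "treeable E" for E by (rule rel[OF that])
  fix I :: "nat set" and T :: "nat \<Rightarrow> pt \<Rightarrow> pt"
  assume "(\<forall>i\<in>I. bij (T i) \<and> mpres (T i) \<and> mpres (inv (T i)))
    \<and> (AE x in mu. \<forall>w. w \<noteq> [] \<and> reduced w \<and> (\<forall>l\<in>set w. fst l \<in> I) \<longrightarrow> act_word UNIV T w x \<noteq> x)"
  then show "sofic_rel {(x, act_word UNIV T w x) | x w. \<forall>l\<in>set w. fst l \<in> I}"
    by (intro rel treeable_of_free_action) auto
qed

end
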